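(* Let $\rho^{AB}$ be a density operator on $\mathcal{H}_A\otimes\mathcal{H}_B$. The following conditions are equivalent: (1) $D(A|B)=S(B)$; (2) $S(A)-S(B)=S(AB)$; (3) $E_F(A:B)=S(B)$.
   Context: All Hilbert spaces are finite-dimensional complex Hilbert spaces. A state is a density operator (positive semidefinite, trace one). Superscripts denote reduced states. The von Neumann entropy is $S(X)=-\mathrm{Tr}\,\rho^X\log_2\rho^X$. The mutual information is $I(A:B)=S(A)+S(B)-S(AB)$. The classical correlation (with measurement on $B$) is $$J(A|B)=\max_{\{E_i^B\}}\Big(S(A)-\sum_i p_i\,S(A|E_i^B)\Big),$$ where the maximum is over all POVMs $\{E_i^B\}$ on $\mathcal{H}_B$, $p_i=\mathrm{Tr}\big((I\otimes E_i^B)\rho^{AB}\big)$, and $S(A|E_i^B)$ is the von Neumann entropy of the post-measurement state $\rho_i^A=\mathrm{Tr}_B\big((I\otimes E_i^B)\rho^{AB}\big)/p_i$ (terms with $p_i=0$ are omitted). The quantum discord (with measurement on $B$) is $D(A|B)=I(A:B)-J(A|B)$. The entanglement of formation is $$E_F(A:B)=\min_{\{p_i,|\psi_i\rangle\}}\sum_i p_i\,S\big(\mathrm{Tr}_B|\psi_i\rangle\langle\psi_i|\big),$$ where the minimum is over all finite ensembles of unit vectors $|\psi_i\rangle\in\mathcal{H}_A\otimes\mathcal{H}_B$ with probabilities $p_i$ such that $\rho^{AB}=\sum_i p_i|\psi_i\rangle\langle\psi_i|$, and $S(\sigma)=-\mathrm{Tr}\,\sigma\log_2\sigma$. *)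

theory Defs
  imports "HOL-Analysis.Analysis"
begin

text \<open>
  A finite-dimensional Hilbert space is \<open>complex ^ 'a\<close> in an orthonormal basis indexed by the finite
  type \<open>'a\<close>; the tensor product of \<open>complex ^ 'a\<close> and \<open>complex ^ 'b\<close> is \<open>complex ^ ('a \<times> 'b)\<close>.
\<close>

definition adj :: "complex ^ 'n ^ 'm \<Rightarrow> complex ^ 'm ^ 'n" where
  "adj M = (\<chi> i j. cnj (M $ j $ i))"

definition unitary :: "complex ^ 'n ^ 'n \<Rightarrow> bool" where
  "unitary U \<longleftrightarrow> adj U ** U = mat 1 \<and> U ** adj U = mat 1"

definition cinner :: "complex ^ 'n \<Rightarrow> complex ^ 'n \<Rightarrow> complex" where
  "cinner v w = (\<Sum>i\<in>UNIV. cnj (v $ i) * w $ i)"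

definition psd :: "complex ^ 'n ^ 'n \<Rightarrow> bool" where
  "psd M \<longleftrightarrow> adj M = M \<and> (\<forall>v. 0 \<le> Re (cinner v (M *v v)))"

definition density_op :: "complex ^ 'n ^ 'n \<Rightarrow> bool" where
  "density_op \<rho> \<longleftrightarrow> psd \<rho> \<and> trace \<rho> = 1"

definition real_diag :: "('n \<Rightarrow> real) \<Rightarrow> complex ^ 'n ^ 'n" where
  "real_diag d = (\<chi> i j. if i = j then complex_of_real (d i) else 0)"

text \<open>
  Functional calculus for Hermitian matrices. Lemma \<open>herm_fun_eq\<close> below shows that the result does
  not depend on the chosen diagonalisation. The value is unspecified for matrices that are not
  Hermitian.
\<close>

definition herm_fun :: "(real \<Rightarrow> real) \<Rightarrow> complex ^ 'n ^ 'n \<Rightarrow> complex ^ 'n ^ 'n" where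
  "herm_fun f M = (THE X. \<exists>U d. unitary U \<and> M = U ** real_diag d ** adj U \<and>
                                X = U ** real_diag (\<lambda>i. f (d i)) ** adj U)"

text \<open>
  Since \<open>log 2 0 = 0\<close> in HOL, zero eigenvalues contribute 0 (the usual convention
  \<open>0 log 0 = 0\<close>).
\<close>

definition vn_entropy :: "complex ^ 'n ^ 'n \<Rightarrow> real" where
  "vn_entropy \<rho> = - Re (trace (\<rho> ** herm_fun (log 2) \<rho>))"

definition tensor :: "complex ^ 'a ^ 'a \<Rightarrow> complex ^ 'b ^ 'b \<Rightarrow> complex ^ ('a::finite \<times> 'b::finite) ^ ('a \<times> 'b)" where
  "tensor M N = (\<chi> i j. M $ fst i $ fst j * N $ snd i $ snd j)"

text \<open>\<open>ptrace_B\<close> traces out the second factor, \<open>ptrace_A\<close> the first.\<close>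

definition ptrace_B :: "complex ^ ('a::finite \<times> 'b::finite) ^ ('a \<times> 'b) \<Rightarrow> complex ^ 'a ^ 'a" where
  "ptrace_B \<rho> = (\<chi> i j. \<Sum>k\<in>UNIV. \<rho> $ (i, k) $ (j, k))"

definition ptrace_A :: "complex ^ ('a::finite \<times> 'b::finite) ^ ('a \<times> 'b) \<Rightarrow> complex ^ 'b ^ 'b" where
  "ptrace_A \<rho> = (\<chi> i j. \<Sum>k\<in>UNIV. \<rho> $ (k, i) $ (k, j))"

definition mutual_information :: "complex ^ ('a::finite \<times> 'b::finite) ^ ('a \<times> 'b) \<Rightarrow> real" where
  "mutual_information \<rho> = vn_entropy (ptrace_B \<rho>) + vn_entropy (ptrace_A \<rho>) - vn_entropy \<rho>"

definition povm :: "nat \<Rightarrow> (nat \<Rightarrow> complex ^ 'b ^ 'b) \<Rightarrow> bool" where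
  "povm n E \<longleftrightarrow> (\<forall>i<n. psd (E i)) \<and> (\<Sum>i<n. E i) = mat 1"

definition outcome_prob ::
    "complex ^ ('a::finite \<times> 'b::finite) ^ ('a \<times> 'b) \<Rightarrow> complex ^ 'b ^ 'b \<Rightarrow> real" where
  "outcome_prob \<rho> F = Re (trace (tensor (mat 1) F ** \<rho>))"

definition post_state ::
    "complex ^ ('a::finite \<times> 'b::finite) ^ ('a \<times> 'b) \<Rightarrow> complex ^ 'b ^ 'b \<Rightarrow> complex ^ 'a ^ 'a" where
  "post_state \<rho> F = (1 / outcome_prob \<rho> F) *\<^sub>R ptrace_B (tensor (mat 1) F ** \<rho>)"

definition measured_gain ::
    "complex ^ ('a::finite \<times> 'b::finite) ^ ('a \<times> 'b) \<Rightarrow> nat \<Rightarrow> (nat \<Rightarrow> complex ^ 'b ^ 'b) \<Rightarrow> real" where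
  "measured_gain \<rho> n E = vn_entropy (ptrace_B \<rho>) -
     (\<Sum>i | i < n \<and> outcome_prob \<rho> (E i) \<noteq> 0. outcome_prob \<rho> (E i) * vn_entropy (post_state \<rho> (E i)))"

text \<open>
  For a state, the supremum here and the infimum in \<open>ent_formation\<close> are over nonempty bounded sets
  of reals and are attained, so they are the maximum and the minimum.
\<close>

definition classical_correlation :: "complex ^ ('a::finite \<times> 'b::finite) ^ ('a \<times> 'b) \<Rightarrow> real" where
  "classical_correlation \<rho> = Sup {measured_gain \<rho> n E | n E. povm n E}"

definition discord :: "complex ^ ('a::finite \<times> 'b::finite) ^ ('a \<times> 'b) \<Rightarrow> real" where
  "discord \<rho> = mutual_information \<rho> - classical_correlation \<rho>"

definition ketbra :: "complex ^ 'n \<Rightarrow> complex ^ 'n ^ 'n" where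
  "ketbra \<psi> = (\<chi> i j. \<psi> $ i * cnj (\<psi> $ j))"

definition pure_ensemble ::
    "complex ^ 'n ^ 'n \<Rightarrow> nat \<Rightarrow> (nat \<Rightarrow> real) \<Rightarrow> (nat \<Rightarrow> complex ^ 'n) \<Rightarrow> bool" where
  "pure_ensemble \<rho> n p \<psi> \<longleftrightarrow> (\<forall>i<n. 0 \<le> p i \<and> norm (\<psi> i) = 1) \<and> (\<Sum>i<n. p i) = 1 \<and>
     \<rho> = (\<Sum>i<n. p i *\<^sub>R ketbra (\<psi> i))"

definition ent_formation :: "complex ^ ('a::finite \<times> 'b::finite) ^ ('a \<times> 'b) \<Rightarrow> real" where
  "ent_formation \<rho> =
     Inf {(\<Sum>i<n. p i * vn_entropy (ptrace_B (ketbra (\<psi> i)))) | n p \<psi>. pure_ensemble \<rho> n p \<psi>}"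

lemma adj_mult: "adj (M ** N) = adj N ** adj M"
  by (simp add: adj_def matrix_matrix_mult_def vec_eq_iff mult.commute)

lemma adj_adj [simp]: "adj (adj M) = M"
  by (simp add: adj_def vec_eq_iff)

lemma mult_real_diag: "(M ** real_diag d) $ i $ j = M $ i $ j * of_real (d j)"
  by (simp add: matrix_matrix_mult_def real_diag_def if_distrib[of "\<lambda>x. _ * x"] cong: if_cong)

lemma real_diag_mult: "(real_diag d ** M) $ i $ j = of_real (d i) * M $ i $ j"
  by (simp add: matrix_matrix_mult_def real_diag_def if_distrib[of "\<lambda>x. x * _"] cong: if_cong)

lemma herm_fun_eq:
  fixes U :: "complex ^ 'n ^ 'n"
  assumes "unitary U"
  shows "herm_fun f (U ** real_diag d ** adj U) = U ** real_diag (\<lambda>i. f (d i)) ** adj U"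
  unfolding herm_fun_def
proof (rule the_equality)
  show "\<exists>V e. unitary V \<and> U ** real_diag d ** adj U = V ** real_diag e ** adj V \<and>
      U ** real_diag (\<lambda>i. f (d i)) ** adj U = V ** real_diag (\<lambda>i. f (e i)) ** adj V"
    using assms by blast
next
  fix X
  assume "\<exists>V e. unitary V \<and> U ** real_diag d ** adj U = V ** real_diag e ** adj V \<and>
      X = V ** real_diag (\<lambda>i. f (e i)) ** adj V"
  then obtain V e where V: "unitary V"
    and eq: "U ** real_diag d ** adj U = V ** real_diag e ** adj V"
    and X: "X = V ** real_diag (\<lambda>i. f (e i)) ** adj V" by blast
  define W where "W = adj V ** U"
  have U1: "adj U ** U = mat 1" "U ** adj U = mat 1" and V1: "adj V ** V = mat 1" "V ** adj V = mat 1"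
    using assms V by (auto simp: unitary_def)
  have "W ** real_diag d = adj V ** (U ** real_diag d ** adj U) ** U"
    unfolding W_def by (metis U1(1) matrix_mul_assoc matrix_mul_rid)
  also have "\<dots> = real_diag e ** W"
    unfolding eq W_def by (metis V1(1) matrix_mul_assoc matrix_mul_lid)
  finally have "W ** real_diag d = real_diag e ** W" .
  then have "W $ i $ j * of_real (d j) = of_real (e i) * W $ i $ j" for i j
    by (metis mult_real_diag real_diag_mult)
  then have "W $ i $ j = 0 \<or> d j = e i" for i j
    by (metis mult.commute mult_cancel_left of_real_eq_iff)
  then have "W ** real_diag (\<lambda>i. f (d i)) = real_diag (\<lambda>i. f (e i)) ** W"
    by (simp add: vec_eq_iff mult_real_diag real_diag_mult) (metis mult.commute mult_zero_left)
  then have "V ** (W ** real_diag (\<lambda>i. f (d i))) ** adj U = V ** (real_diag (\<lambda>i. f (e i)) ** W) ** adj U"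
    by simp
  moreover have "V ** (W ** real_diag (\<lambda>i. f (d i))) ** adj U = U ** real_diag (\<lambda>i. f (d i)) ** adj U"
    unfolding W_def by (metis V1(2) matrix_mul_assoc matrix_mul_lid)
  moreover have "V ** (real_diag (\<lambda>i. f (e i)) ** W) ** adj U = X"
    unfolding W_def X by (metis U1(2) matrix_mul_assoc matrix_mul_rid)
  ultimately show "X = U ** real_diag (\<lambda>i. f (d i)) ** adj U" by simp
qed

end

theory Submission
  imports Defs
begin

text \<open>
  Purify \<open>\<rho>\<close> by an environment \<open>C\<close>, so that \<open>S(A) = S(BC)\<close> and \<open>S(AB) = S(C)\<close>. Condition (2) is then
  equality in the subadditivity of the entropy of \<open>BC\<close>, that is, \<open>\<rho>\<close> has a product marginal on \<open>BC\<close>.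
  A rank-one measurement on \<open>B\<close> leaves \<open>AC\<close> in pure states, whose marginals on \<open>A\<close> and \<open>C\<close> have equal
  entropy; by concavity the average entropy is at most \<open>S(C)\<close>. Condition (1) says that
  \<open>J(A|B) = S(A) - S(C)\<close>, so every such average equals \<open>S(C)\<close>, and the equality case of concavity
  makes all conditional states on \<open>C\<close> coincide, which again means that \<open>BC\<close> is in a product state.
  Condition (3) is the same argument with \<open>B\<close> and \<open>C\<close> exchanged, as the pure state ensembles of
  \<open>\<rho>\<close> arise from rank-one measurements on \<open>C\<close>. In both cases only bounds for the supremum or infimum
  enter, so that its attainment need not be known beforehand.
\<close>

subsection \<open>Diagonalisation of Hermitian matrices\<close>

lemma Re_cinner_eq_inner: "Re (cinner v w) = v \<bullet> w"
  by (simp add: cinner_def inner_vec_def inner_complex_def)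

lemma cinner_add_right: "cinner u (v + w) = cinner u v + cinner u w"
  by (simp add: cinner_def algebra_simps sum.distrib)

lemma cinner_diff_right: "cinner u (v - w) = cinner u v - cinner u w"
  by (simp add: cinner_def algebra_simps sum_subtractf)

lemma cinner_scaleR_right: "cinner u (c *\<^sub>R v) = of_real c * cinner u v"
  by (simp add: cinner_def sum_distrib_left vector_scaleR_component scaleR_conv_of_real[where 'a=complex] mult_ac)

lemma cnj_cinner: "cnj (cinner v w) = cinner w v"
  by (simp add: cinner_def mult.commute)

lemma cinner_self: "cinner v v = of_real ((norm v)\<^sup>2)"
proof -
  have "cinner v v = of_real (Re (cinner v v))"
    using cnj_cinner[of v v] by (simp add: complex_eq_iff)
  then show ?thesis
    by (simp add: Re_cinner_eq_inner power2_norm_eq_inner)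
qed

lemma cinner_matrix: "cinner v (M *v w) = cinner (adj M *v v) w"
  unfolding cinner_def adj_def matrix_vector_mult_def
  by (simp add: sum_distrib_left sum_distrib_right mult_ac) (rule sum.swap)

lemma continuous_on_cinner_right: "continuous_on S (\<lambda>x. cinner v x)"
  unfolding cinner_def by (intro continuous_intros)

lemma mat_vec_scaleR: "M *v (c *\<^sub>R x) = c *\<^sub>R (M *v x)" for M :: "complex ^ 'n ^ 'm"
  by (simp add: matrix_vector_mult_def vec_eq_iff scaleR_sum_right)

lemma mat_vec_diff: "M *v (x - y) = M *v x - M *v y" for M :: "complex ^ 'n ^ 'm"
  by (simp add: matrix_vector_mult_def vec_eq_iff algebra_simps sum_subtractf)

lemma continuous_on_mat_vec: "continuous_on S (\<lambda>x. M *v x)" for M :: "complex ^ 'n ^ 'm"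
  unfolding matrix_vector_mult_def by (intro continuous_intros)

text \<open>Rayleigh quotient: a maximiser on the unit sphere of the invariant subspace is an eigenvector.\<close>

lemma hermitian_eigenvector_orthogonal:
  fixes M :: "complex ^ 'n ^ 'n" and v :: "'i \<Rightarrow> complex ^ 'n"
  assumes herm: "adj M = M"
    and eig: "\<And>i. i \<in> S \<Longrightarrow> M *v v i = d i *\<^sub>R v i"
    and x: "x \<noteq> 0" "\<And>i. i \<in> S \<Longrightarrow> cinner (v i) x = 0"
  obtains y l where "norm y = 1" "\<And>i. i \<in> S \<Longrightarrow> cinner (v i) y = 0" "M *v y = l *\<^sub>R y"
proof -
  define W where "W = {y. \<forall>i\<in>S. cinner (v i) y = 0}"
  define K where "K = sphere 0 1 \<inter> W"
  have "closed {y. cinner (v i) y = 0}" for i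
    by (intro closed_Collect_eq continuous_on_cinner_right continuous_on_const)
  then have "closed W"
    unfolding W_def Collect_ball_eq by (intro closed_INT) auto
  then have K: "compact K"
    unfolding K_def by (intro compact_Int_closed) auto
  have "(1 / norm x) *\<^sub>R x \<in> K"
    using x by (auto simp: K_def W_def cinner_scaleR_right)
  then have ne: "K \<noteq> {}" by blast
  have "continuous_on K (\<lambda>y. y \<bullet> (M *v y))"
    by (intro continuous_intros continuous_on_mat_vec)
  from continuous_attains_sup[OF K ne this] obtain y
    where y: "y \<in> K" and max: "\<And>z. z \<in> K \<Longrightarrow> z \<bullet> (M *v z) \<le> y \<bullet> (M *v y)" by blast
  have ny: "norm y = 1" and yW: "y \<in> W" using y by (auto simp: K_def)
  define l where "l = y \<bullet> (M *v y)"
  \<comment> \<open>\<open>B\<close> is the operator \<open>l - M\<close>. By maximality of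
    \<open>l\<close> its quadratic form is nonnegative on \<open>W\<close>, and it vanishes at
    \<open>y\<close>; it remains to see that this forces \<open>B y = 0\<close>.\<close>
  define B where "B z = l *\<^sub>R z - M *v z" for z
  have Bpos: "0 \<le> z \<bullet> B z" if "z \<in> W" for z
  proof (cases "z = 0")
    case False
    let ?u = "(1 / norm z) *\<^sub>R z"
    have "?u \<in> K"
      using False that by (auto simp: K_def W_def cinner_scaleR_right)
    from max[OF this] have "(z \<bullet> (M *v z)) / (norm z)\<^sup>2 \<le> l"
      by (simp add: l_def mat_vec_scaleR power2_eq_square)
    then have "z \<bullet> (M *v z) \<le> l * (norm z)\<^sup>2"
      using False by (simp add: field_simps)
    then show ?thesis
      by (simp add: B_def inner_diff_right power2_norm_eq_inner)
  qed (simp add: B_def)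
  have Wdiff: "a - c *\<^sub>R b \<in> W" if "a \<in> W" "b \<in> W" for a b c
    using that by (simp add: W_def cinner_diff_right cinner_scaleR_right)
  have MW: "M *v z \<in> W" if "z \<in> W" for z
  proof -
    have "cinner (v i) (M *v z) = cnj (cinner z (d i *\<^sub>R v i))" if "i \<in> S" for i
      using that by (simp add: cinner_matrix herm eig cnj_cinner)
    then show ?thesis
      using that by (auto simp: W_def cinner_scaleR_right cnj_cinner)
  qed
  define z where "z = B y"
  have "0 - (- l) *\<^sub>R y - 1 *\<^sub>R (M *v y) \<in> W"
    by (intro Wdiff MW yW) (simp add: W_def cinner_def)
  then have zW: "z \<in> W" by (simp add: z_def B_def)
  have symM: "a \<bullet> (M *v b) = (M *v a) \<bullet> b" for a b
    using arg_cong[OF cinner_matrix[of a M b], of Re] by (simp only: Re_cinner_eq_inner herm)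
  have sym: "a \<bullet> B b = B a \<bullet> b" for a b
    by (simp add: B_def inner_diff_right inner_diff_left symM)
  have yBy: "y \<bullet> B y = 0"
    using ny power2_norm_eq_inner[of y] by (simp add: B_def l_def inner_diff_right)
  have Bdiff: "B (a - c *\<^sub>R b) = B a - c *\<^sub>R B b" for a b c
    by (simp add: B_def mat_vec_diff mat_vec_scaleR algebra_simps)
  \<comment> \<open>The form is nonnegative at \<open>y - t z\<close>, where the linear term is
    \<open>-2 t |z|^2\<close> because \<open>z = B y\<close>. For small positive \<open>t\<close>
    this term would dominate unless \<open>z = 0\<close>.\<close>
  have quad: "2 * t * (z \<bullet> z) \<le> t\<^sup>2 * (z \<bullet> B z)" for t
  proof -
    have "0 \<le> (y - t *\<^sub>R z) \<bullet> B (y - t *\<^sub>R z)"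
      by (intro Bpos Wdiff yW zW)
    also have "\<dots> = - 2 * t * (z \<bullet> z) + t\<^sup>2 * (z \<bullet> B z)"
      unfolding Bdiff
      using yBy sym[of y z]
      by (simp add: inner_diff_right inner_diff_left z_def[symmetric] power2_eq_square algebra_simps)
    finally show ?thesis by simp
  qed
  have "z \<bullet> z = 0"
  proof (rule ccontr)
    assume "z \<bullet> z \<noteq> 0"
    then have pos: "z \<bullet> z > 0" by simp
    define c where "c = z \<bullet> B z"
    have c: "c \<ge> 0" unfolding c_def by (rule Bpos[OF zW])
    \<comment> \<open>The summand 1 keeps the denominator positive when
      \<open>c = 0\<close>.\<close>
    define t where "t = (z \<bullet> z) / (c + 1)"
    have t: "t > 0" using pos c by (simp add: t_def)
    have "2 * (z \<bullet> z) \<le> t * c"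
      using quad[of t] t by (simp add: power2_eq_square c_def)
    also have "\<dots> \<le> z \<bullet> z"
      using pos c by (simp add: t_def field_simps)
    finally show False using pos by simp
  qed
  then have "M *v y = l *\<^sub>R y" by (simp add: z_def B_def)
  with ny yW show ?thesis by (intro that[of y l]) (auto simp: W_def)
qed

text \<open>Eigenvectors are found one at a time. Indexing them by a subset of the coordinate type
  guarantees that, as long as an index is left, some nonzero vector is orthogonal to those already
  found; the Rayleigh argument then supplies the next one.\<close>

lemma orthonormal_eigenvectors:
  fixes M :: "complex ^ 'n ^ 'n" and S :: "'n set"
  assumes herm: "adj M = M"
  shows "\<exists>v d. (\<forall>i\<in>S. \<forall>j\<in>S. cinner (v i) (v j) = (if i = j then 1 else 0)) \<and>
           (\<forall>i\<in>S. M *v v i = d i *\<^sub>R v i)"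
  using finite[of S]
proof (induction S rule: finite_induct)
  case (insert s S)
  then obtain v d where v: "\<And>i j. i \<in> S \<Longrightarrow> j \<in> S \<Longrightarrow> cinner (v i) (v j) = (if i = j then 1 else 0)"
    and d: "\<And>i. i \<in> S \<Longrightarrow> M *v v i = d i *\<^sub>R v i" by blast
  \<comment> \<open>Row \<open>s\<close> is zero, so \<open>A\<close> is singular; its kernel
    consists of the vectors orthogonal to every \<open>v i\<close> with \<open>i\<close> in
    \<open>S\<close>.\<close>
  define A :: "complex ^ 'n ^ 'n" where "A = (\<chi> i j. if i \<in> S then cnj (v i $ j) else 0)"
  have "row s A = 0" using insert.hyps by (simp add: A_def row_def vec_eq_iff)
  then have "det A = 0" by (rule det_zero_row(1))
  then have "\<not> (\<exists>B. B ** A = mat 1)"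
    by (metis invertible_det_nz invertible_left_inverse)
  then obtain x where x: "x \<noteq> 0" "A *v x = 0"
    using matrix_left_invertible_ker[of A] by blast
  have "cinner (v i) x = 0" if "i \<in> S" for i
  proof -
    have "cinner (v i) x = (A *v x) $ i"
      using that by (simp add: cinner_def A_def matrix_vector_mult_def)
    then show ?thesis using x by simp
  qed
  then obtain y l
    where y: "norm y = 1" "\<And>i. i \<in> S \<Longrightarrow> cinner (v i) y = 0" "M *v y = l *\<^sub>R y"
    using hermitian_eigenvector_orthogonal[of M S v d x, OF herm d x(1)] by blast
  have y': "cinner y (v i) = 0" if "i \<in> S" for i
    using y(2)[OF that] cnj_cinner[of "v i" y] by simp
  have "cinner y y = 1" using y by (simp add: cinner_self)
  then show ?case
    using v d y y' insert.hyps
    by (intro exI[of _ "v(s := y)"] exI[of _ "d(s := l)"]) auto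
qed simp

theorem hermitian_diagonalisation:
  fixes M :: "complex ^ 'n ^ 'n"
  assumes "adj M = M"
  obtains U d where "unitary U" "M = U ** real_diag d ** adj U"
proof -
  obtain v :: "'n \<Rightarrow> complex ^ 'n" and d where v: "\<forall>i j. cinner (v i) (v j) = (if i = j then 1 else 0)"
    and d: "\<forall>i. M *v v i = d i *\<^sub>R v i"
    using orthonormal_eigenvectors[OF assms, of UNIV] by (metis UNIV_I)
  define U :: "complex ^ 'n ^ 'n" where "U = (\<chi> i j. v j $ i)"
  have "adj U ** U = mat 1"
    using v by (simp add: U_def adj_def matrix_matrix_mult_def mat_def vec_eq_iff cinner_def)
  moreover from this have "U ** adj U = mat 1"
    by (simp add: matrix_left_right_inverse)
  ultimately have U: "unitary U" by (simp add: unitary_def)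
  have "M ** U = U ** real_diag d"
    unfolding vec_eq_iff mult_real_diag
    using d by (simp add: U_def matrix_matrix_mult_def matrix_vector_mult_def vec_eq_iff
        scaleR_conv_of_real[where 'a=complex] mult.commute)
  then have "M = U ** real_diag d ** adj U"
    using U by (metis matrix_mul_assoc matrix_mul_rid unitary_def)
  with U show ?thesis by (rule that)
qed

subsection \<open>Positive matrices and entropy\<close>

lemma adj_mat_1: "adj (mat 1 :: complex ^ 'n ^ 'n) = mat 1"
  by (simp add: adj_def mat_def vec_eq_iff)

lemma unitary_mat_1: "unitary (mat 1 :: complex ^ 'n ^ 'n)"
  by (simp add: unitary_def adj_mat_1)

lemma unitary_adj: "unitary U \<Longrightarrow> unitary (adj U)"
  by (simp add: unitary_def)

lemma unitary_mult: "unitary U \<Longrightarrow> unitary V \<Longrightarrow> unitary (U ** V)"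
  unfolding unitary_def adj_mult by (metis matrix_mul_assoc matrix_mul_rid)

lemma unitary_cancel:
  assumes "unitary U"
  shows "adj U ** U = mat 1" "U ** adj U = mat 1"
    "X ** adj U ** U = X" "Y ** U ** adj U = Y"
  using assms by (auto simp: unitary_def simp flip: matrix_mul_assoc)

lemma adj_real_diag [simp]: "adj (real_diag d) = real_diag d"
  by (simp add: adj_def real_diag_def vec_eq_iff)

lemma real_diag_mult_real_diag: "real_diag a ** real_diag b = real_diag (\<lambda>i. a i * b i)"
  by (simp add: vec_eq_iff mult_real_diag) (simp add: real_diag_def)

lemma scaleR_real_diag: "c *\<^sub>R real_diag d = real_diag (\<lambda>i. c * d i)"
  by (simp add: real_diag_def vec_eq_iff scaleR_conv_of_real[where 'a=complex])

lemma trace_real_diag: "trace (real_diag d) = of_real (\<Sum>i\<in>UNIV. d i)"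
  by (simp add: trace_def real_diag_def)

lemma trace_unitary_conj: "unitary U \<Longrightarrow> trace (U ** X ** adj U) = trace X"
  by (metis matrix_mul_assoc matrix_mul_lid trace_mul_sym unitary_def)

lemma matrix_scaleR_left: "(c *\<^sub>R A) ** B = c *\<^sub>R (A ** B)" for A :: "complex ^ 'n ^ 'm"
  by (simp add: matrix_matrix_mult_def vec_eq_iff scaleR_sum_right)

lemma matrix_scaleR_right: "A ** (c *\<^sub>R B) = c *\<^sub>R (A ** B)" for A :: "complex ^ 'n ^ 'm"
  by (simp add: matrix_matrix_mult_def vec_eq_iff scaleR_sum_right)

lemma matrix_sum_left: "(\<Sum>k\<in>K. A k) ** B = (\<Sum>k\<in>K. A k ** B)" for B :: "complex ^ 'n ^ 'm"
  by (simp add: matrix_matrix_mult_def vec_eq_iff sum_distrib_right) (intro allI sum.swap)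

lemma matrix_sum_right: "B ** (\<Sum>k\<in>K. A k) = (\<Sum>k\<in>K. B ** A k)" for B :: "complex ^ 'n ^ 'm"
  by (simp add: matrix_matrix_mult_def vec_eq_iff sum_distrib_left) (intro allI sum.swap)

lemma trace_scaleR: "trace (c *\<^sub>R A) = c *\<^sub>R trace A" for A :: "complex ^ 'n ^ 'n"
  by (simp add: trace_def scaleR_sum_right)

lemma trace_zero [simp]: "trace (0 :: complex ^ 'n ^ 'n) = 0"
  by (simp add: trace_def)

lemma trace_sum: "trace (\<Sum>k\<in>K. A k) = (\<Sum>k\<in>K. trace (A k))" for A :: "'k \<Rightarrow> complex ^ 'n ^ 'n"
  by (induction K rule: infinite_finite_induct) (simp_all add: trace_add)

lemma adj_scaleR: "adj (c *\<^sub>R A) = c *\<^sub>R adj A"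
  by (simp add: adj_def vec_eq_iff)

lemma conj_entry: "(adj V ** M ** V) $ i $ j = cinner (column i V) (M *v column j V)"
  by (simp add: cinner_def adj_def column_def matrix_matrix_mult_def matrix_vector_mult_def
      sum_distrib_left sum_distrib_right mult_ac) (rule sum.swap)

lemma psd_conj_diag: "psd M \<Longrightarrow> 0 \<le> Re ((adj V ** M ** V) $ j $ j)"
  by (simp add: conj_entry psd_def)

lemma psd_adj_mult: "psd (adj N ** N)"
proof -
  have "cinner v ((adj N ** N) *v v) = cinner (N *v v) (N *v v)" for v
    by (simp add: cinner_matrix[of v "adj N"] flip: matrix_vector_mul_assoc)
  then show ?thesis
    by (simp add: psd_def adj_mult cinner_self)
qed

lemma psd_mult_adj: "psd (N ** adj N)"
  using psd_adj_mult[of "adj N"] by simp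

lemma psd_scaleR: "psd M \<Longrightarrow> 0 \<le> c \<Longrightarrow> psd (c *\<^sub>R M)"
  by (simp add: psd_def adj_scaleR Re_cinner_eq_inner)
     (simp add: matrix_vector_mult_def inner_vec_def flip: scaleR_sum_right sum_distrib_left)

lemma psd_sum: "(\<And>k. k \<in> K \<Longrightarrow> psd (M k)) \<Longrightarrow> psd (\<Sum>k\<in>K. M k)"
proof (induction K rule: infinite_finite_induct)
  case (insert x F)
  then show ?case
    by (auto simp: psd_def adj_def vec_eq_iff matrix_vector_mult_add_rdistrib cinner_add_right)
qed (auto simp: psd_def adj_def vec_eq_iff cinner_def matrix_vector_mult_def)

lemma psd_diagonalisation:
  fixes M :: "complex ^ 'n ^ 'n"
  assumes "psd M"
  obtains U d where "unitary U" "M = U ** real_diag d ** adj U" "\<And>i. 0 \<le> d i"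
proof -
  obtain U d where U: "unitary U" and M: "M = U ** real_diag d ** adj U"
    using hermitian_diagonalisation assms unfolding psd_def by blast
  have "adj U ** M ** U = real_diag d"
    by (simp add: M unitary_cancel[OF U] matrix_mul_assoc)
  then have "0 \<le> d i" for i
    using psd_conj_diag[OF assms, of U i] by (simp add: real_diag_def)
  with U M show ?thesis by (rule that)
qed

lemma psd_trace_eq_0:
  assumes "psd M" "Re (trace M) = 0"
  shows "M = 0"
proof -
  obtain U d where U: "unitary U" and M: "M = U ** real_diag d ** adj U" and d: "\<And>i. 0 \<le> d i"
    using psd_diagonalisation assms(1) by blast
  have "(\<Sum>i\<in>UNIV. d i) = 0"
    using assms(2) by (simp add: M trace_unitary_conj[OF U] trace_real_diag)
  then have "d i = 0" for i
    using d by (simp add: sum_nonneg_eq_0_iff)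
  then have "real_diag d = 0" by (simp add: real_diag_def vec_eq_iff)
  then show ?thesis by (simp add: M)
qed

lemma psd_trace_nonneg: "psd M \<Longrightarrow> 0 \<le> Re (trace M)"
  using psd_conj_diag[of M "mat 1"] by (simp add: adj_mat_1 trace_def sum_nonneg)

lemma psd_trace_real:
  assumes "psd M"
  shows "trace M = of_real (Re (trace M))"
proof -
  have "cnj (M $ i $ i) = M $ i $ i" for i
    using assms by (simp add: psd_def adj_def vec_eq_iff)
  then have "cnj (trace M) = trace M" by (simp add: trace_def)
  then show ?thesis by (simp add: complex_eq_iff)
qed

section \<open>Entropy as a function of the spectrum\<close>

lemma vn_entropy_diag:
  assumes "unitary U"
  shows "vn_entropy (U ** real_diag d ** adj U) = - (\<Sum>i\<in>UNIV. d i * log 2 (d i))"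
  by (simp add: vn_entropy_def herm_fun_eq[OF assms] matrix_mul_assoc unitary_cancel[OF assms])
     (simp add: trace_unitary_conj[OF assms] real_diag_mult_real_diag trace_real_diag
       flip: matrix_mul_assoc[of U "real_diag _" "real_diag _"])

lemma vn_entropy_nonneg:
  assumes "density_op \<rho>"
  shows "0 \<le> vn_entropy \<rho>"
proof -
  obtain U d where U: "unitary U" and M: "\<rho> = U ** real_diag d ** adj U" and d: "\<And>i. 0 \<le> d i"
    using psd_diagonalisation assms unfolding density_op_def by blast
  have "Re (trace \<rho>) = 1" using assms by (simp add: density_op_def)
  then have s: "(\<Sum>i\<in>UNIV. d i) = 1"
    by (simp add: M trace_unitary_conj[OF U] trace_real_diag)
  have "d i * log 2 (d i) \<le> 0" for i
  proof -
    have "d i \<le> 1" using member_le_sum[of i UNIV d] d s by simp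
    then show ?thesis using d[of i]
      by (cases "d i = 0") (auto simp: mult_nonneg_nonpos less_le)
  qed
  then show ?thesis
    by (simp add: M vn_entropy_diag[OF U] sum_nonpos)
qed

text \<open>Nonzero singular values match: a nonzero entry of \<open>W\<close> forces equality of the eigenvalues it links.\<close>

lemma vn_entropy_gram:
  fixes M :: "complex ^ 'n ^ 'm"
  shows "vn_entropy (M ** adj M) = vn_entropy (adj M ** M)"
proof -
  obtain U d where U: "unitary U" and d: "M ** adj M = U ** real_diag d ** adj U"
    using hermitian_diagonalisation[of "M ** adj M"] by (auto simp: adj_mult)
  obtain V e where V: "unitary V" and e: "adj M ** M = V ** real_diag e ** adj V"
    using hermitian_diagonalisation[of "adj M ** M"] by (auto simp: adj_mult)
  define W where "W = adj U ** M ** V"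
  have WW: "W ** adj W = real_diag d"
  proof -
    have "W ** adj W = adj U ** (M ** adj M) ** U"
      by (simp add: W_def adj_mult matrix_mul_assoc unitary_cancel[OF V])
    then show ?thesis by (simp add: d matrix_mul_assoc unitary_cancel[OF U])
  qed
  have WW': "adj W ** W = real_diag e"
  proof -
    have "adj W ** W = adj V ** (adj M ** M) ** V"
      by (simp add: W_def adj_mult matrix_mul_assoc unitary_cancel[OF U])
    then show ?thesis by (simp add: e matrix_mul_assoc unitary_cancel[OF V])
  qed
  \<comment> \<open>Both sides are entries of \<open>W ** adj W ** W\<close>.\<close>
  have "(real_diag d ** W) $ i $ j = (W ** real_diag e) $ i $ j" for i j
    by (simp flip: WW WW' add: matrix_mul_assoc)
  then have eq: "W $ i $ j = 0 \<or> d i = e j" for i j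
    by (metis mult.commute mult_cancel_left mult_real_diag of_real_eq_iff real_diag_mult)
  have "(W ** adj W) $ i $ i = of_real (d i)" for i
    unfolding WW by (simp add: real_diag_def)
  then have "complex_of_real (\<Sum>j\<in>UNIV. (cmod (W $ i $ j))\<^sup>2) = of_real (d i)" for i
    unfolding of_real_sum complex_norm_square by (simp add: matrix_matrix_mult_def adj_def)
  then have dW: "d i = (\<Sum>j\<in>UNIV. (cmod (W $ i $ j))\<^sup>2)" for i
    by (metis of_real_eq_iff)
  have "(adj W ** W) $ j $ j = of_real (e j)" for j
    unfolding WW' by (simp add: real_diag_def)
  then have "complex_of_real (\<Sum>i\<in>UNIV. (cmod (W $ i $ j))\<^sup>2) = of_real (e j)" for j
    unfolding of_real_sum complex_norm_square by (simp add: matrix_matrix_mult_def adj_def mult.commute)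
  then have eW: "e j = (\<Sum>i\<in>UNIV. (cmod (W $ i $ j))\<^sup>2)" for j
    by (metis of_real_eq_iff)
  have "(\<Sum>i\<in>UNIV. d i * log 2 (d i)) = (\<Sum>i\<in>UNIV. \<Sum>j\<in>UNIV. (cmod (W $ i $ j))\<^sup>2 * log 2 (d i))"
    unfolding sum_distrib_right[symmetric] dW[symmetric] ..
  also have "\<dots> = (\<Sum>i\<in>UNIV. \<Sum>j\<in>UNIV. (cmod (W $ i $ j))\<^sup>2 * log 2 (e j))"
    using eq by (intro sum.cong refl) (metis mult_zero_left norm_zero zero_power2)
  also have "\<dots> = (\<Sum>j\<in>UNIV. e j * log 2 (e j))"
    by (subst sum.swap) (simp only: sum_distrib_right[symmetric] eW[symmetric])
  finally show ?thesis
    by (simp add: d e vn_entropy_diag[OF U] vn_entropy_diag[OF V])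
qed

text \<open>Transposition conjugates the eigenbasis and keeps the spectrum. It is needed because the
  reductions of a purification onto \<open>B\<close> come out transposed.\<close>

lemma vn_entropy_transpose:
  assumes "adj M = M"
  shows "vn_entropy (transpose M) = vn_entropy M"
proof -
  obtain U d where U: "unitary U" and M: "M = U ** real_diag d ** adj U"
    using hermitian_diagonalisation[OF assms] by blast
  define V where "V = transpose (adj U)"
  have adjV: "adj V = transpose U" by (simp add: V_def adj_def transpose_def vec_eq_iff)
  have V: "unitary V"
    using U unfolding unitary_def adjV unfolding V_def by (simp flip: matrix_transpose_mul)
  have "transpose (real_diag d) = real_diag d"
    by (simp add: transpose_def real_diag_def vec_eq_iff)
  then have "transpose M = V ** real_diag d ** adj V"
    unfolding adjV by (simp add: M matrix_transpose_mul V_def matrix_mul_assoc)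
  then show ?thesis by (simp add: M vn_entropy_diag[OF U] vn_entropy_diag[OF V])
qed

subsection \<open>Klein's inequality and concavity\<close>

text \<open>This is \<open>ln t \<le> t - 1\<close>, with equality only at \<open>t = 1\<close>,
  taken at \<open>t = y / x\<close>. The support condition excludes \<open>y = 0 < x\<close>, where
  the default \<open>ln 0 = 0\<close> would stand in for minus infinity.\<close>

lemma ln_diff_lower_bound:
  fixes x y :: real
  assumes "0 \<le> x" "0 \<le> y" "y = 0 \<Longrightarrow> x = 0"
  shows "x - y \<le> x * (ln x - ln y)" "x - y = x * (ln x - ln y) \<Longrightarrow> x = y"
proof -
  have "x - y \<le> x * (ln x - ln y) \<and> (x - y = x * (ln x - ln y) \<longrightarrow> x = y)"
  proof (cases "x = 0")
    case False
    with assms have pos: "0 < x" "0 < y" by (auto simp: less_le)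
    have e: "x * (ln x - ln y) = x - y + x * ((y / x - 1) - ln (y / x))"
      using pos by (simp add: ln_div field_simps)
    have "0 \<le> (y / x - 1) - ln (y / x)"
      using ln_le_minus_one[of "y / x"] pos by simp
    moreover have "y / x = 1" if "(y / x - 1) - ln (y / x) = 0"
      using ln_eq_minus_one[of "y / x"] that pos by simp
    ultimately show ?thesis unfolding e using pos by auto
  qed (use assms in auto)
  then show "x - y \<le> x * (ln x - ln y)" "x - y = x * (ln x - ln y) \<Longrightarrow> x = y" by auto
qed

text \<open>The extension of the entropy from states to positive matrices that is homogeneous of
  degree one. For an unnormalised conditional state it is the probability times the entropy, that
  is, one term of an average; a vanishing trace gives 0.\<close>

definition weighted_entropy :: "complex ^ 'n ^ 'n \<Rightarrow> real" where
  "weighted_entropy M = Re (trace M) * vn_entropy ((1 / Re (trace M)) *\<^sub>R M)"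

lemma weighted_entropy_scaleR: "weighted_entropy (c *\<^sub>R M) = c * weighted_entropy M"
  by (cases "c = 0") (simp_all add: weighted_entropy_def trace_scaleR)

lemma weighted_entropy_trace_1: "trace M = 1 \<Longrightarrow> weighted_entropy M = vn_entropy M"
  by (simp add: weighted_entropy_def)

text \<open>The matrix of squared moduli of the overlaps of the two eigenbases is doubly stochastic, which
  reduces the claim to the scalar inequality.\<close>

lemma klein_inequality:
  fixes \<tau> V :: "complex ^ 'n ^ 'n"
  assumes \<tau>: "psd \<tau>" and V: "unitary V" and e: "\<And>j. 0 \<le> e j" "(\<Sum>j\<in>UNIV. e j) = 1"
    and r: "\<And>j. r j = Re ((adj V ** \<tau> ** V) $ j $ j)"
    and supp: "\<And>j. e j = 0 \<Longrightarrow> r j = 0"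
  shows "weighted_entropy \<tau> \<le> - (\<Sum>j\<in>UNIV. r j * log 2 (e j))"
    and "weighted_entropy \<tau> = - (\<Sum>j\<in>UNIV. r j * log 2 (e j)) \<Longrightarrow>
           \<tau> = Re (trace \<tau>) *\<^sub>R (V ** real_diag e ** adj V)"
proof -
  define p where "p = Re (trace \<tau>)"
  have "weighted_entropy \<tau> \<le> - (\<Sum>j\<in>UNIV. r j * log 2 (e j)) \<and>
      (weighted_entropy \<tau> = - (\<Sum>j\<in>UNIV. r j * log 2 (e j)) \<longrightarrow>
           \<tau> = p *\<^sub>R (V ** real_diag e ** adj V))"
  proof (cases "p = 0")
    case True
    then have "\<tau> = 0" using psd_trace_eq_0[OF \<tau>] by (simp add: p_def)
    moreover from this have "r j = 0" for j
      by (simp add: r matrix_matrix_mult_def)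
    ultimately show ?thesis using True by (simp add: weighted_entropy_def p_def[symmetric])
  next
    case False
    then have p: "p > 0" using psd_trace_nonneg[OF \<tau>] by (simp add: p_def)
    obtain U d0 where U: "unitary U" and \<tau>0: "\<tau> = U ** real_diag d0 ** adj U" and d0: "\<And>i. 0 \<le> d0 i"
      using psd_diagonalisation[OF \<tau>] by blast
    define d where "d i = d0 i / p" for i
    have d: "0 \<le> d i" for i using d0 p by (simp add: d_def)
    have "p *\<^sub>R real_diag d = real_diag d0"
      using p by (simp add: scaleR_real_diag d_def)
    then have \<tau>d: "\<tau> = p *\<^sub>R (U ** real_diag d ** adj U)"
      using \<tau>0 by (metis matrix_scaleR_left matrix_scaleR_right)
    have "p = p * (\<Sum>i\<in>UNIV. d i)"
      using arg_cong[OF \<tau>d, of "\<lambda>M. Re (trace M)"]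
      by (simp add: trace_scaleR trace_unitary_conj[OF U] trace_real_diag flip: p_def)
    then have sd: "(\<Sum>i\<in>UNIV. d i) = 1" using p by simp
    define W where "W = adj U ** V"
    have W: "unitary W" using U V by (simp add: W_def unitary_mult unitary_adj)
    define P where "P i j = (cmod (W $ i $ j))\<^sup>2" for i j
    have P0: "0 \<le> P i j" for i j by (simp add: P_def)
    have "complex_of_real (\<Sum>j\<in>UNIV. P i j) = of_real 1" for i
    proof -
      have "(W ** adj W) $ i $ i = 1" using W by (simp add: unitary_def mat_def)
      then show ?thesis
        unfolding of_real_sum P_def complex_norm_square by (simp add: matrix_matrix_mult_def adj_def)
    qed
    then have P1: "(\<Sum>j\<in>UNIV. P i j) = 1" for i by (metis of_real_eq_iff)
    have "complex_of_real (\<Sum>i\<in>UNIV. P i j) = of_real 1" for j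
    proof -
      have "(adj W ** W) $ j $ j = 1" using W by (simp add: unitary_def mat_def)
      then show ?thesis
        unfolding of_real_sum P_def complex_norm_square
        by (simp add: matrix_matrix_mult_def adj_def mult.commute)
    qed
    then have P2: "(\<Sum>i\<in>UNIV. P i j) = 1" for j by (metis of_real_eq_iff)
    have rP: "r j = p * (\<Sum>i\<in>UNIV. P i j * d i)" for j
    proof -
      have "adj V ** \<tau> ** V = p *\<^sub>R (adj W ** (real_diag d ** W))"
        by (simp add: \<tau>d W_def adj_mult matrix_scaleR_left matrix_scaleR_right matrix_mul_assoc)
      then have "(adj V ** \<tau> ** V) $ j $ j = p *\<^sub>R (\<Sum>i\<in>UNIV. cnj (W $ i $ j) * (of_real (d i) * W $ i $ j))"
        by (simp add: matrix_matrix_mult_def[of "adj W"] real_diag_mult) (simp add: adj_def)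
      also have "\<dots> = of_real (p * (\<Sum>i\<in>UNIV. P i j * d i))"
        by (simp add: P_def complex_norm_square[symmetric] scaleR_conv_of_real mult_ac del: of_real_power)
      finally show ?thesis by (simp add: r)
    qed
    \<comment> \<open>The nonnegative terms of a vanishing sum all vanish. This secures the support
      condition of the scalar inequality wherever \<open>P i j\<close> is nonzero.\<close>
    have supp': "P i j = 0 \<or> d i = 0" if "e j = 0" for i j
    proof -
      have "(\<Sum>i\<in>UNIV. P i j * d i) = 0" using supp[OF that] rP p by simp
      then show ?thesis using P0 d by (simp add: sum_nonneg_eq_0_iff)
    qed
    \<comment> \<open>The defect of the scalar inequality for the pair \<open>d i\<close>,
      \<open>e j\<close>, weighted by the overlap. The linear parts cancel in the total, since
      \<open>d\<close> and \<open>e\<close> both sum to 1.\<close>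
    define g where "g i j = P i j * (d i * (ln (d i) - ln (e j)) - (d i - e j))" for i j
    have g: "0 \<le> g i j" and g0: "g i j = 0 \<Longrightarrow> P i j = 0 \<or> d i = e j" for i j
    proof -
      have "0 \<le> g i j \<and> (g i j = 0 \<longrightarrow> P i j = 0 \<or> d i = e j)"
      proof (cases "P i j = 0")
        case False
        then have *: "e j = 0 \<Longrightarrow> d i = 0" using supp' by blast
        show ?thesis
          using ln_diff_lower_bound[OF d e(1) *] P0 False by (auto simp: g_def)
      qed (simp add: g_def)
      then show "0 \<le> g i j" "g i j = 0 \<Longrightarrow> P i j = 0 \<or> d i = e j" by auto
    qed
    have "(\<Sum>i\<in>UNIV. \<Sum>j\<in>UNIV. g i j) =
        (\<Sum>i\<in>UNIV. \<Sum>j\<in>UNIV. P i j * (d i * ln (d i))) - (\<Sum>i\<in>UNIV. \<Sum>j\<in>UNIV. P i j * d i * ln (e j))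
        - ((\<Sum>i\<in>UNIV. \<Sum>j\<in>UNIV. P i j * d i) - (\<Sum>i\<in>UNIV. \<Sum>j\<in>UNIV. P i j * e j))"
      by (simp add: g_def algebra_simps sum.distrib sum_subtractf)
    also have "(\<Sum>i\<in>UNIV. \<Sum>j\<in>UNIV. P i j * (d i * ln (d i))) = (\<Sum>i\<in>UNIV. d i * ln (d i))"
      by (simp add: P1 flip: sum_distrib_right)
    also have "(\<Sum>i\<in>UNIV. \<Sum>j\<in>UNIV. P i j * d i) = 1"
      by (simp add: P1 sd flip: sum_distrib_right)
    also have "(\<Sum>i\<in>UNIV. \<Sum>j\<in>UNIV. P i j * e j) = 1"
      by (subst sum.swap) (simp add: P2 e flip: sum_distrib_right)
    also have "(\<Sum>i\<in>UNIV. \<Sum>j\<in>UNIV. P i j * d i * ln (e j)) = (\<Sum>j\<in>UNIV. r j * ln (e j)) / p"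
      by (subst sum.swap) (simp add: rP sum_divide_distrib p flip: sum_distrib_right, use p in auto)
    finally have G: "(\<Sum>i\<in>UNIV. \<Sum>j\<in>UNIV. g i j) =
        (\<Sum>i\<in>UNIV. d i * ln (d i)) - (\<Sum>j\<in>UNIV. r j * ln (e j)) / p" by simp
    have "weighted_entropy \<tau> = p * vn_entropy (U ** real_diag d ** adj U)"
      unfolding weighted_entropy_def p_def[symmetric] by (subst \<tau>d) (use p in simp)
    also have "\<dots> = - p * (\<Sum>i\<in>UNIV. d i * ln (d i)) / ln 2"
      by (simp add: vn_entropy_diag[OF U] log_def flip: sum_divide_distrib)
    \<comment> \<open>The gap is \<open>p\<close> times the relative entropy of the normalised
      \<open>\<tau>\<close> with respect to the state with eigenvalues \<open>e\<close> and
      eigenbasis \<open>V\<close>. It is a positive multiple of the total of \<open>g\<close>, so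
      equality makes every \<open>g i j\<close> vanish.\<close>
    finally have "- (\<Sum>j\<in>UNIV. r j * log 2 (e j)) - weighted_entropy \<tau> =
        p * (\<Sum>i\<in>UNIV. \<Sum>j\<in>UNIV. g i j) / ln 2"
      using p unfolding G by (simp add: log_def field_simps flip: sum_divide_distrib)
    moreover have "0 \<le> p * (\<Sum>i\<in>UNIV. \<Sum>j\<in>UNIV. g i j) / ln 2"
      using p by (simp add: sum_nonneg g)
    moreover have "\<tau> = p *\<^sub>R (V ** real_diag e ** adj V)" if "(\<Sum>i\<in>UNIV. \<Sum>j\<in>UNIV. g i j) = 0"
    proof -
      have "g i j = 0" for i j
        using that g by (simp add: sum_nonneg_eq_0_iff sum_nonneg)
      then have "W $ i $ j = 0 \<or> d i = e j" for i j
        using g0[of i j] by (simp add: P_def)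
      \<comment> \<open>Equal eigenvalues wherever the overlap is nonzero mean that \<open>W\<close>
        intertwines the two diagonals, hence that the two states coincide.\<close>
      then have "real_diag d ** W = W ** real_diag e"
        unfolding vec_eq_iff mult_real_diag real_diag_mult by (metis mult.commute mult_zero_left)
      then have "U ** (real_diag d ** W) ** adj V = U ** (W ** real_diag e) ** adj V" by simp
      then have "U ** real_diag d ** adj U = V ** real_diag e ** adj V"
        by (simp add: W_def matrix_mul_assoc unitary_cancel[OF U] unitary_cancel[OF V])
      then show ?thesis by (simp add: \<tau>d)
    qed
    ultimately show ?thesis using p by (intro conjI impI) (linarith, simp)
  qed
  then show "weighted_entropy \<tau> \<le> - (\<Sum>j\<in>UNIV. r j * log 2 (e j))"
    and "weighted_entropy \<tau> = - (\<Sum>j\<in>UNIV. r j * log 2 (e j)) \<Longrightarrow>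
           \<tau> = Re (trace \<tau>) *\<^sub>R (V ** real_diag e ** adj V)"
    by (auto simp: p_def)
qed

text \<open>Klein's inequality compares each \<open>\<tau> k\<close> with the total
  \<open>\<sigma>\<close>. In the eigenbasis of \<open>\<sigma>\<close> the diagonals of the
  \<open>\<tau> k\<close> add up to its spectrum, so the upper bounds add up to its entropy;
  equality of the sums forces equality in every term.\<close>

lemma entropy_concave:
  fixes \<tau> :: "'k \<Rightarrow> complex ^ 'n ^ 'n"
  assumes K: "finite K" and \<tau>: "\<And>k. k \<in> K \<Longrightarrow> psd (\<tau> k)"
    and \<sigma>: "\<sigma> = (\<Sum>k\<in>K. \<tau> k)" "trace \<sigma> = 1"
  shows "(\<Sum>k\<in>K. weighted_entropy (\<tau> k)) \<le> vn_entropy \<sigma>"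
    and "(\<Sum>k\<in>K. weighted_entropy (\<tau> k)) = vn_entropy \<sigma> \<Longrightarrow> k \<in> K \<Longrightarrow>
           \<tau> k = Re (trace (\<tau> k)) *\<^sub>R \<sigma>"
proof -
  have "psd \<sigma>" using \<tau> by (simp add: \<sigma> psd_sum)
  then obtain V e where V: "unitary V" and \<sigma>e: "\<sigma> = V ** real_diag e ** adj V" and e: "\<And>i. 0 \<le> e i"
    using psd_diagonalisation by blast
  have "complex_of_real (\<Sum>j\<in>UNIV. e j) = of_real 1"
    using \<sigma>(2) by (simp only: \<sigma>e trace_unitary_conj[OF V] trace_real_diag of_real_1)
  then have se: "(\<Sum>j\<in>UNIV. e j) = 1" by (simp only: of_real_eq_iff)
  define r where "r k j = Re ((adj V ** \<tau> k ** V) $ j $ j)" for k j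
  have r0: "0 \<le> r k j" if "k \<in> K" for k j
    unfolding r_def by (intro psd_conj_diag \<tau> that)
  have er: "e j = (\<Sum>k\<in>K. r k j)" for j
  proof -
    have "real_diag e = (\<Sum>k\<in>K. adj V ** \<tau> k ** V)"
      unfolding matrix_sum_left[symmetric] matrix_sum_right[symmetric] \<sigma>(1)[symmetric]
      by (simp add: \<sigma>e matrix_mul_assoc unitary_cancel[OF V])
    then have "real_diag e $ j $ j = (\<Sum>k\<in>K. (adj V ** \<tau> k ** V) $ j $ j)" by simp
    then show ?thesis by (simp add: r_def real_diag_def complex_eq_iff)
  qed
  have supp: "r k j = 0" if "e j = 0" "k \<in> K" for k j
    using that r0 K by (simp add: er sum_nonneg_eq_0_iff)
  note kl = klein_inequality[OF \<tau> V e se r_def supp]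
  have S: "(\<Sum>k\<in>K. - (\<Sum>j\<in>UNIV. r k j * log 2 (e j))) = vn_entropy \<sigma>"
    unfolding sum_negf \<sigma>e vn_entropy_diag[OF V]
    by (subst sum.swap) (simp only: sum_distrib_right[symmetric] er[symmetric])
  show "(\<Sum>k\<in>K. weighted_entropy (\<tau> k)) \<le> vn_entropy \<sigma>"
    unfolding S[symmetric] by (intro sum_mono kl(1)) auto
  show "\<tau> k = Re (trace (\<tau> k)) *\<^sub>R \<sigma>"
    if "(\<Sum>k\<in>K. weighted_entropy (\<tau> k)) = vn_entropy \<sigma>" "k \<in> K"
  proof -
    have "weighted_entropy (\<tau> k) = - (\<Sum>j\<in>UNIV. r k j * log 2 (e j))"
    proof (rule sum_mono_inv[OF that(1)[folded S] _ that(2) K])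
      show "weighted_entropy (\<tau> i) \<le> - (\<Sum>j\<in>UNIV. r i j * log 2 (e j))" if "i \<in> K" for i
        by (rule kl(1)) (use that in auto)
    qed
    then show ?thesis
      unfolding \<sigma>e by (intro kl(2)) (use that in auto)
  qed
qed

subsection \<open>Subadditivity\<close>

lemma sum_UNIV_prod: "(\<Sum>p\<in>UNIV. f p) = (\<Sum>i\<in>UNIV. \<Sum>j\<in>UNIV. f (i, j))"
  by (simp add: sum.cartesian_product)

lemma tensor_mult: "tensor A B ** tensor C D = tensor (A ** C) (B ** D)"
  by (simp add: tensor_def matrix_matrix_mult_def vec_eq_iff sum_UNIV_prod sum_product mult_ac)

lemma adj_tensor: "adj (tensor A B) = tensor (adj A) (adj B)"
  by (simp add: tensor_def adj_def vec_eq_iff)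

lemma tensor_mat_1: "tensor (mat 1) (mat 1) = mat 1"
  by (auto simp: tensor_def mat_def vec_eq_iff)

lemma unitary_tensor: "unitary U \<Longrightarrow> unitary V \<Longrightarrow> unitary (tensor U V)"
  by (simp add: unitary_def adj_tensor tensor_mult tensor_mat_1)

lemma tensor_real_diag: "tensor (real_diag d) (real_diag e) = real_diag (\<lambda>p. d (fst p) * e (snd p))"
  by (auto simp: tensor_def real_diag_def vec_eq_iff)

lemma tensor_1_entries:
  "(tensor A (mat 1) ** X) $ (i, k) $ q = (\<Sum>j\<in>UNIV. A $ i $ j * X $ (j, k) $ q)"
  "(X ** tensor A (mat 1)) $ q $ (i, k) = (\<Sum>j\<in>UNIV. X $ q $ (j, k) * A $ j $ i)"
  "(tensor (mat 1) B ** X) $ (i, k) $ q = (\<Sum>j\<in>UNIV. B $ k $ j * X $ (i, j) $ q)"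
  "(X ** tensor (mat 1) B) $ q $ (i, k) = (\<Sum>j\<in>UNIV. X $ q $ (i, j) * B $ j $ k)"
     apply (simp_all add: tensor_def mat_def matrix_matrix_mult_def sum_UNIV_prod if_distrib if_distribR cong: if_cong)
   apply (subst sum.swap, simp)+
  done

lemma ptrace_B_conj: "ptrace_B (tensor A (mat 1) ** X ** tensor C (mat 1)) = A ** ptrace_B X ** C"
  by (simp add: ptrace_B_def vec_eq_iff tensor_1_entries)
     (simp add: matrix_matrix_mult_def sum_distrib_left sum_distrib_right mult_ac,
      intro allI, subst sum.swap, intro sum.cong refl sum.swap)

lemma ptrace_A_conj: "ptrace_A (tensor (mat 1) A ** X ** tensor (mat 1) C) = A ** ptrace_A X ** C"
  by (simp add: ptrace_A_def vec_eq_iff tensor_1_entries)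
     (simp add: matrix_matrix_mult_def sum_distrib_left sum_distrib_right mult_ac,
      intro allI, subst sum.swap, intro sum.cong refl sum.swap)

lemma ptrace_B_cyclic: "ptrace_B (tensor (mat 1) B ** X) = ptrace_B (X ** tensor (mat 1) B)"
  by (simp add: ptrace_B_def vec_eq_iff tensor_1_entries mult.commute) (intro allI sum.swap)

lemma ptrace_A_cyclic: "ptrace_A (tensor B (mat 1) ** X) = ptrace_A (X ** tensor B (mat 1))"
  by (simp add: ptrace_A_def vec_eq_iff tensor_1_entries mult.commute) (intro allI sum.swap)

text \<open>Local factors commute, so either may be innermost. Each partial trace needs the factor
  on the traced system inside, where cyclicity removes it, and the other one outside.\<close>

lemma tensor_conj:
  "adj (tensor U V) ** X ** tensor U V =
     tensor (adj U) (mat 1) ** (tensor (mat 1) (adj V) ** X ** tensor (mat 1) V) ** tensor U (mat 1)"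
  "adj (tensor U V) ** X ** tensor U V =
     tensor (mat 1) (adj V) ** (tensor (adj U) (mat 1) ** X ** tensor U (mat 1)) ** tensor (mat 1) V"
proof -
  have "tensor U V = tensor (mat 1) V ** tensor U (mat 1)" "tensor U V = tensor U (mat 1) ** tensor (mat 1) V"
    "adj (tensor U V) = tensor (adj U) (mat 1) ** tensor (mat 1) (adj V)"
    "adj (tensor U V) = tensor (mat 1) (adj V) ** tensor (adj U) (mat 1)"
    by (simp_all add: tensor_mult adj_tensor)
  then show "adj (tensor U V) ** X ** tensor U V =
     tensor (adj U) (mat 1) ** (tensor (mat 1) (adj V) ** X ** tensor (mat 1) V) ** tensor U (mat 1)"
  "adj (tensor U V) ** X ** tensor U V =
     tensor (mat 1) (adj V) ** (tensor (adj U) (mat 1) ** X ** tensor U (mat 1)) ** tensor (mat 1) V"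
    by (metis matrix_mul_assoc)+
qed

lemma ptrace_B_unitary_conj:
  assumes "unitary V"
  shows "ptrace_B (adj (tensor U V) ** X ** tensor U V) = adj U ** ptrace_B X ** U"
proof -
  have "ptrace_B (tensor (mat 1) (adj V) ** X ** tensor (mat 1) V) = ptrace_B X"
    using assms by (simp add: ptrace_B_cyclic tensor_mult unitary_def tensor_mat_1 flip: matrix_mul_assoc)
  then show ?thesis by (simp add: tensor_conj(1) ptrace_B_conj)
qed

lemma ptrace_A_unitary_conj:
  assumes "unitary U"
  shows "ptrace_A (adj (tensor U V) ** X ** tensor U V) = adj V ** ptrace_A X ** V"
proof -
  have "ptrace_A (tensor (adj U) (mat 1) ** X ** tensor U (mat 1)) = ptrace_A X"
    using assms by (simp add: ptrace_A_cyclic tensor_mult unitary_def tensor_mat_1 flip: matrix_mul_assoc)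
  then show ?thesis by (simp add: tensor_conj(2) ptrace_A_conj)
qed

lemma trace_ptrace_B: "trace (ptrace_B X) = trace X"
  by (simp add: trace_def ptrace_B_def sum_UNIV_prod)

lemma trace_ptrace_A: "trace (ptrace_A X) = trace X"
  by (simp add: trace_def ptrace_A_def sum_UNIV_prod) (rule sum.swap)

lemma psd_gram:
  fixes M :: "complex ^ 'n ^ 'n"
  assumes "psd M"
  obtains N :: "complex ^ 'n ^ 'n" where "M = adj N ** N"
proof -
  obtain U d where U: "unitary U" and M: "M = U ** real_diag d ** adj U" and d: "\<And>i. 0 \<le> d i"
    using psd_diagonalisation assms by blast
  have "real_diag d = real_diag (\<lambda>i. sqrt (d i)) ** real_diag (\<lambda>i. sqrt (d i))"
    using d by (simp add: real_diag_mult_real_diag)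
  then have "M = adj (real_diag (\<lambda>i. sqrt (d i)) ** adj U) ** (real_diag (\<lambda>i. sqrt (d i)) ** adj U)"
    by (simp add: M adj_mult matrix_mul_assoc)
  then show ?thesis by (rule that)
qed

lemma psd_ptrace_B:
  fixes X :: "complex ^ ('a::finite \<times> 'b::finite) ^ ('a \<times> 'b)"
  assumes "psd X"
  shows "psd (ptrace_B X)"
proof -
  obtain N :: "complex ^ ('a \<times> 'b) ^ ('a \<times> 'b)" where "X = adj N ** N" using psd_gram assms by blast
  \<comment> \<open>Moving the traced index from the columns of the Gram factor to its rows turns a
    Gram factor of \<open>X\<close> into one of its partial trace.\<close>
  moreover define S where "S = (\<chi> p x. N $ fst p $ (x, snd p))"
  ultimately have "ptrace_B X = adj S ** S"
    by (simp add: ptrace_B_def matrix_matrix_mult_def adj_def vec_eq_iff sum_UNIV_prod,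
        intro allI, subst sum.swap, intro sum.cong refl sum.swap)
  then show ?thesis by (simp add: psd_adj_mult)
qed

lemma psd_ptrace_A:
  fixes X :: "complex ^ ('a::finite \<times> 'b::finite) ^ ('a \<times> 'b)"
  assumes "psd X"
  shows "psd (ptrace_A X)"
proof -
  obtain N :: "complex ^ ('a \<times> 'b) ^ ('a \<times> 'b)" where "X = adj N ** N" using psd_gram assms by blast
  moreover define S where "S = (\<chi> p x. N $ fst p $ (snd p, x))"
  ultimately have "ptrace_A X = adj S ** S"
    by (simp add: ptrace_A_def matrix_matrix_mult_def adj_def vec_eq_iff sum_UNIV_prod,
        intro allI, subst sum.swap, intro sum.cong refl sum.swap)
  then show ?thesis by (simp add: psd_adj_mult)
qed

text \<open>Klein's inequality for \<open>X\<close> against the product of its marginals, whose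
  eigenvalues are \<open>d i * e j\<close>. The diagonal of \<open>X\<close> in the product
  eigenbasis has marginals \<open>d\<close> and \<open>e\<close>, so the cross term is the sum of
  the marginal entropies, and additivity is the equality case.\<close>

theorem entropy_additive_iff_product:
  fixes X :: "complex ^ ('x::finite \<times> 'y::finite) ^ ('x \<times> 'y)"
  assumes "density_op X"
  shows "vn_entropy X = vn_entropy (ptrace_B X) + vn_entropy (ptrace_A X) \<longleftrightarrow>
         X = tensor (ptrace_B X) (ptrace_A X)"
proof -
  have X: "psd X" "trace X = 1" using assms by (auto simp: density_op_def)
  obtain U d where U: "unitary U" and d: "ptrace_B X = U ** real_diag d ** adj U" and d0: "\<And>i. 0 \<le> d i"
    using psd_diagonalisation[OF psd_ptrace_B[OF X(1)]] by blast
  obtain V e where V: "unitary V" and e: "ptrace_A X = V ** real_diag e ** adj V" and e0: "\<And>i. 0 \<le> e i"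
    using psd_diagonalisation[OF psd_ptrace_A[OF X(1)]] by blast
  have "complex_of_real (\<Sum>i\<in>UNIV. d i) = of_real 1"
    using trace_ptrace_B[of X] X(2) by (simp only: d trace_unitary_conj[OF U] trace_real_diag of_real_1)
  then have sd: "(\<Sum>i\<in>UNIV. d i) = 1" by (simp only: of_real_eq_iff)
  have "complex_of_real (\<Sum>i\<in>UNIV. e i) = of_real 1"
    using trace_ptrace_A[of X] X(2) by (simp only: e trace_unitary_conj[OF V] trace_real_diag of_real_1)
  then have se: "(\<Sum>i\<in>UNIV. e i) = 1" by (simp only: of_real_eq_iff)
  let ?Q = "tensor U V"
  define f where "f p = d (fst p) * e (snd p)" for p
  define r where "r p = Re ((adj ?Q ** X ** ?Q) $ p $ p)" for p
  have r0: "0 \<le> r p" for p unfolding r_def by (rule psd_conj_diag[OF X(1)])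
  have Q: "unitary ?Q" by (rule unitary_tensor[OF U V])
  have prod: "?Q ** real_diag f ** adj ?Q = tensor (ptrace_B X) (ptrace_A X)"
    unfolding f_def tensor_real_diag[symmetric] d e adj_tensor tensor_mult ..
  have rd: "(\<Sum>j\<in>UNIV. r (i, j)) = d i" for i
  proof -
    have "ptrace_B (adj ?Q ** X ** ?Q) $ i $ i = real_diag d $ i $ i"
      by (simp add: ptrace_B_unitary_conj[OF V] d matrix_mul_assoc unitary_cancel[OF U])
    then show ?thesis by (simp add: ptrace_B_def r_def real_diag_def complex_eq_iff)
  qed
  have re: "(\<Sum>i\<in>UNIV. r (i, j)) = e j" for j
  proof -
    have "ptrace_A (adj ?Q ** X ** ?Q) $ j $ j = real_diag e $ j $ j"
      by (simp add: ptrace_A_unitary_conj[OF U] e matrix_mul_assoc unitary_cancel[OF V])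
    then show ?thesis by (simp add: ptrace_A_def r_def real_diag_def complex_eq_iff)
  qed
  have supp: "r p = 0" if "f p = 0" for p
  proof -
    obtain i j where p: "p = (i, j)" by (cases p)
    then have "(\<Sum>j\<in>UNIV. r (i, j)) = 0 \<or> (\<Sum>i\<in>UNIV. r (i, j)) = 0"
      using that by (auto simp: f_def rd re)
    then show ?thesis
      using r0 by (auto simp: p sum_nonneg_eq_0_iff)
  qed
  have sf: "(\<Sum>p\<in>UNIV. f p) = 1"
    by (simp add: sum_UNIV_prod f_def sd se flip: sum_distrib_left)
  have f0: "0 \<le> f p" for p by (simp add: f_def d0 e0)
  \<comment> \<open>The logarithm splits only for positive factors; where one of them vanishes, so
    does the weight \<open>r\<close>.\<close>
  have log: "r (i, j) * log 2 (f (i, j)) = r (i, j) * log 2 (d i) + r (i, j) * log 2 (e j)" for i j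
  proof (cases "f (i, j) = 0")
    case False
    then have "d i > 0" "e j > 0" using d0[of i] e0[of j] by (auto simp: f_def less_le)
    then show ?thesis by (simp add: f_def log_mult algebra_simps)
  qed (simp add: supp)
  have "(\<Sum>p\<in>UNIV. r p * log 2 (f p)) =
      (\<Sum>i\<in>UNIV. \<Sum>j\<in>UNIV. r (i, j) * log 2 (d i)) + (\<Sum>i\<in>UNIV. \<Sum>j\<in>UNIV. r (i, j) * log 2 (e j))"
    by (simp add: sum_UNIV_prod log sum.distrib)
  also have "(\<Sum>i\<in>UNIV. \<Sum>j\<in>UNIV. r (i, j) * log 2 (d i)) = (\<Sum>i\<in>UNIV. d i * log 2 (d i))"
    by (simp add: rd flip: sum_distrib_right)
  also have "(\<Sum>i\<in>UNIV. \<Sum>j\<in>UNIV. r (i, j) * log 2 (e j)) = (\<Sum>j\<in>UNIV. e j * log 2 (e j))"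
    by (subst sum.swap) (simp add: re flip: sum_distrib_right)
  finally have S: "vn_entropy (ptrace_B X) + vn_entropy (ptrace_A X) = - (\<Sum>p\<in>UNIV. r p * log 2 (f p))"
    by (simp add: d e vn_entropy_diag[OF U] vn_entropy_diag[OF V])
  show ?thesis
  proof
    assume "vn_entropy X = vn_entropy (ptrace_B X) + vn_entropy (ptrace_A X)"
    then have "weighted_entropy X = - (\<Sum>p\<in>UNIV. r p * log 2 (f p))"
      using X by (simp add: weighted_entropy_trace_1 S)
    from klein_inequality(2)[OF X(1) Q f0 sf r_def supp this]
    show "X = tensor (ptrace_B X) (ptrace_A X)" using X by (simp add: prod)
  next
    assume X': "X = tensor (ptrace_B X) (ptrace_A X)"
    have "adj ?Q ** X ** ?Q = real_diag f"
      by (subst X') (simp add: matrix_mul_assoc unitary_cancel[OF Q] flip: prod)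
    then have "r p = f p" for p by (simp add: r_def real_diag_def)
    moreover have "vn_entropy X = - (\<Sum>p\<in>UNIV. f p * log 2 (f p))"
      by (subst X') (simp add: vn_entropy_diag[OF Q] flip: prod)
    ultimately show "vn_entropy X = vn_entropy (ptrace_B X) + vn_entropy (ptrace_A X)"
      by (simp add: S)
  qed
qed

subsection \<open>Slices of a tripartite vector\<close>

lemma cinner_add_left: "cinner (u + v) w = cinner u w + cinner v w"
  by (simp add: cinner_def algebra_simps sum.distrib)

lemma cinner_scalar_right: "cinner u (c *s v) = c * cinner u v"
  by (simp add: cinner_def sum_distrib_left mult_ac)

lemma cinner_scalar_left: "cinner (c *s u) v = cnj c * cinner u v"
  by (simp add: cinner_def sum_distrib_left mult_ac)

lemma matrix_vector_axis: "M *v axis j 1 = column j M" for M :: "complex ^ 'n ^ 'm"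
  by (simp add: matrix_vector_mult_def column_def axis_def vec_eq_iff if_distrib cong: if_cong)

lemma cinner_axis: "cinner (axis i 1) (M *v axis j 1) = M $ i $ j"
proof -
  have "cinner (axis i 1) w = w $ i" for w :: "complex ^ 'a"
    by (simp add: cinner_def axis_def if_distrib if_distribR cong: if_cong)
  then show ?thesis by (simp add: matrix_vector_axis column_def)
qed

text \<open>Complex scalars are essential: the form is later applied to off-diagonal blocks, which
  need not be Hermitian.\<close>

lemma complex_polarization:
  fixes M :: "complex ^ 'n ^ 'n"
  assumes q: "\<And>w. cinner w (M *v w) = 0"
  shows "M = 0"
proof -
  have "cinner u (M *v v) = 0" for u v
  proof -
    have *: "cinner a (M *v b) + cinner b (M *v a) = 0" for a b
      using q[of "a + b"] q[of a] q[of b]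
      by (simp add: matrix_vector_right_distrib cinner_add_left cinner_add_right add.commute)
    \<comment> \<open>Replacing \<open>v\<close> by \<open>\<i> *s v\<close> flips the relative sign
      of the two mixed terms, which separates them.\<close>
    have "M *v (\<i> *s v) = \<i> *s (M *v v)"
      by (rule vector_scalar_commute)
    then have "\<i> * cinner u (M *v v) - \<i> * cinner v (M *v u) = 0"
      using *[of u "\<i> *s v"] by (simp add: cinner_scalar_left cinner_scalar_right)
    then have "cinner u (M *v v) = cinner v (M *v u)" by simp
    then show ?thesis using *[of u v] by simp
  qed
  then have "M $ i $ j = 0" for i j by (metis cinner_axis)
  then show ?thesis by (simp add: vec_eq_iff)
qed

lemma ketbra_entry: "ketbra w $ i $ j = w $ i * cnj (w $ j)"
  by (simp add: ketbra_def)

lemma real_diag_off: "i \<noteq> j \<Longrightarrow> real_diag d $ i $ j = 0"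
  by (simp add: real_diag_def)

text \<open>Diagonalise the rank-one operator of the vector.\<close>

lemma multiple_of_unitary_column:
  fixes w :: "complex ^ 'n"
  obtains U k c where "unitary U" "w = c *s column k U"
proof -
  have "adj (ketbra w) = ketbra w" by (simp add: adj_def ketbra_def vec_eq_iff mult.commute)
  then obtain U d where U: "unitary U" and d: "ketbra w = U ** real_diag d ** adj U"
    using hermitian_diagonalisation by blast
  define u where "u = adj U *v w"
  have w: "w = U *v u"
    using U by (simp add: u_def matrix_vector_mul_assoc unitary_def)
  have "ketbra u = adj U ** ketbra w ** U"
    by (simp add: u_def vec_eq_iff ketbra_def matrix_vector_mult_def matrix_matrix_mult_def adj_def
        sum_product sum_distrib_left sum_distrib_right mult_ac)
  also have "\<dots> = real_diag d" by (simp add: d matrix_mul_assoc unitary_cancel[OF U])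
  finally have "ketbra u $ i $ j = real_diag d $ i $ j" for i j by simp
  \<comment> \<open>A rank-one operator that is diagonal belongs to a vector with at most one
    nonzero coordinate.\<close>
  then have off: "u $ i = 0 \<or> u $ j = 0" if "i \<noteq> j" for i j
    by (metis complex_cnj_zero_iff mult_eq_0_iff ketbra_entry real_diag_off that)
  obtain k where "\<And>i. i \<noteq> k \<Longrightarrow> u $ i = 0" using off by metis
  then have "u = u $ k *s axis k 1" by (auto simp: vec_eq_iff axis_def)
  then have "w = u $ k *s column k U"
    by (metis w vector_scalar_commute matrix_vector_axis)
  with U show ?thesis by (rule that)
qed

text \<open>\<open>slice T w\<close> is the vector obtained from the tripartite vector \<open>T\<close> by contracting its second
  factor with \<open>w\<close>, written as a matrix. The reduced operator of \<open>T\<close> on the last two factors is the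
  complex conjugate of \<open>adj T ** T\<close>.\<close>

definition slice ::
  "complex ^ ('x::finite \<times> 'y::finite) ^ 'a \<Rightarrow> complex ^ 'x \<Rightarrow> complex ^ 'y ^ 'a" where
  "slice T w = (\<chi> a y. \<Sum>x\<in>UNIV. T $ a $ (x, y) * w $ x)"

text \<open>Entry \<open>(y, y')\<close> of the slice is the quadratic form of the corresponding
  block of \<open>adj T ** T\<close>, so polarisation recovers the whole operator from its
  slices.\<close>

lemma slice_gram:
  fixes T :: "complex ^ ('x::finite \<times> 'y::finite) ^ 'a"
  shows "(adj (slice T w) ** slice T w) $ y $ y' =
    cinner w ((\<chi> x x'. (adj T ** T) $ (x, y) $ (x', y')) *v w)"
proof -
  have "(adj (slice T w) ** slice T w) $ y $ y' =
      (\<Sum>a\<in>UNIV. \<Sum>x\<in>UNIV. \<Sum>x'\<in>UNIV. cnj (w $ x) * (cnj (T $ a $ (x, y)) * T $ a $ (x', y') * w $ x'))"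
    by (simp add: matrix_matrix_mult_def adj_def slice_def sum_product) (simp only: mult_ac)
  also have "\<dots> = (\<Sum>x\<in>UNIV. \<Sum>x'\<in>UNIV. \<Sum>a\<in>UNIV. cnj (w $ x) * (cnj (T $ a $ (x, y)) * T $ a $ (x', y') * w $ x'))"
    by (subst sum.swap, intro sum.cong refl sum.swap)
  also have "\<dots> = cinner w ((\<chi> x x'. (adj T ** T) $ (x, y) $ (x', y')) *v w)"
    by (simp add: cinner_def matrix_vector_mult_def matrix_matrix_mult_def adj_def
        sum_distrib_left sum_distrib_right)
  finally show ?thesis .
qed

lemma matrix_vector_sum_left: "(\<Sum>k\<in>K. A k) *v v = (\<Sum>k\<in>K. A k *v v)" for v :: "complex ^ 'n"
  by (induction K rule: infinite_finite_induct) (simp_all add: matrix_vector_mult_add_rdistrib)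

lemma cinner_sum_right: "cinner u (\<Sum>k\<in>K. v k) = (\<Sum>k\<in>K. cinner u (v k))"
  by (simp add: cinner_def sum_distrib_left) (rule sum.swap)

lemma trace_slice_gram:
  fixes T :: "complex ^ ('x::finite \<times> 'y::finite) ^ 'a"
  shows "trace (adj (slice T w) ** slice T w) = cinner w (ptrace_B (adj T ** T) *v w)"
proof -
  have "trace (adj (slice T w) ** slice T w) =
      cinner w ((\<Sum>y\<in>UNIV. \<chi> x x'. (adj T ** T) $ (x, y) $ (x', y)) *v w)"
    unfolding matrix_vector_sum_left cinner_sum_right by (simp add: trace_def slice_gram)
  also have "(\<Sum>y\<in>UNIV. \<chi> x x'. (adj T ** T) $ (x, y) $ (x', y)) = ptrace_B (adj T ** T)"
    by (simp add: ptrace_B_def vec_eq_iff)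
  finally show ?thesis .
qed

lemma sum_columns_unitary:
  assumes "unitary U"
  shows "(\<Sum>k\<in>UNIV. cinner (column k U) (M *v column k U)) = trace M"
proof -
  have "(\<Sum>k\<in>UNIV. cinner (column k U) (M *v column k U)) = trace (adj U ** M ** U)"
    by (simp add: trace_def conj_entry)
  also have "\<dots> = trace M"
    using trace_unitary_conj[OF unitary_adj[OF assms], of M] by simp
  finally show ?thesis .
qed

text \<open>Measuring one factor in an orthonormal basis decomposes the marginal of the other factor
  into conditional operators; this is the decomposition fed into concavity.\<close>

lemma sum_slice_gram:
  fixes T :: "complex ^ ('x::finite \<times> 'y::finite) ^ 'a"
  assumes "unitary U"
  shows "(\<Sum>k\<in>UNIV. adj (slice T (column k U)) ** slice T (column k U)) = ptrace_A (adj T ** T)"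
  by (simp add: vec_eq_iff slice_gram sum_columns_unitary[OF assms]) (simp add: trace_def ptrace_A_def)

lemma slice_product:
  fixes T :: "complex ^ ('x::finite \<times> 'y::finite) ^ 'a"
  assumes prod: "adj T ** T = tensor P Q" and Q: "trace Q = 1"
  shows "adj (slice T w) ** slice T w = Re (trace (adj (slice T w) ** slice T w)) *\<^sub>R Q"
proof -
  define c where "c = cinner w (P *v w)"
  have "(\<chi> x x'. (adj T ** T) $ (x, y) $ (x', y')) *v w = Q $ y $ y' *s (P *v w)" for y y'
    by (simp add: prod tensor_def vec_eq_iff matrix_vector_mult_def sum_distrib_left mult_ac)
  then have e: "(adj (slice T w) ** slice T w) $ y $ y' = c * Q $ y $ y'" for y y'
    by (simp add: slice_gram cinner_scalar_right c_def mult.commute)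
  then have "trace (adj (slice T w) ** slice T w) = c * trace Q"
    by (simp add: trace_def sum_distrib_left)
  then have "trace (adj (slice T w) ** slice T w) = c" using Q by simp
  then have "of_real (Re (trace (adj (slice T w) ** slice T w))) = c"
    using psd_trace_real[OF psd_adj_mult, of "slice T w"] by simp
  then show ?thesis
    by (simp add: vec_eq_iff e scaleR_conv_of_real[where 'a=complex])
qed

text \<open>The hypothesis equates two quadratic forms on the columns of unitaries. Since every
  vector is a multiple of such a column, homogeneity extends the equality to all vectors, and
  polarisation extends it to the blocks themselves.\<close>

lemma product_if_slices:
  fixes T :: "complex ^ ('x::finite \<times> 'y::finite) ^ 'a"
  assumes "\<And>U k. unitary U \<Longrightarrow> adj (slice T (column k U)) ** slice T (column k U) =
    Re (trace (adj (slice T (column k U)) ** slice T (column k U))) *\<^sub>R Q"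
  shows "adj T ** T = tensor (ptrace_B (adj T ** T)) Q"
proof -
  let ?X = "adj T ** T" and ?P = "ptrace_B (adj T ** T)"
  have "(\<chi> x x'. ?X $ (x, y) $ (x', y') - ?P $ x $ x' * Q $ y $ y') = 0" (is "?M y y' = 0") for y y'
  proof (rule complex_polarization)
    fix w :: "complex ^ 'x"
    have M: "cinner u (?M y y' *v u) = (adj (slice T u) ** slice T u) $ y $ y' - Q $ y $ y' * cinner u (?P *v u)" for u
    proof -
      have "?M y y' *v u = (\<chi> x x'. ?X $ (x, y) $ (x', y')) *v u - Q $ y $ y' *s (?P *v u)"
        by (simp add: vec_eq_iff matrix_vector_mult_def sum_distrib_left sum_subtractf algebra_simps)
      then show ?thesis by (simp add: cinner_diff_right cinner_scalar_right slice_gram)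
    qed
    obtain U k c where U: "unitary U" and w: "w = c *s column k U"
      by (rule multiple_of_unitary_column)
    let ?u = "column k U"
    have "cinner ?u (?P *v ?u) = of_real (Re (trace (adj (slice T ?u) ** slice T ?u)))"
      using psd_trace_real[OF psd_adj_mult, of "slice T ?u"] by (simp add: trace_slice_gram)
    then have "cinner ?u (?M y y' *v ?u) = 0"
      unfolding M using arg_cong[OF assms[OF U, of k], of "\<lambda>R. R $ y $ y'"]
      by (simp add: scaleR_conv_of_real[where 'a=complex])
    then show "cinner w (?M y y' *v w) = 0"
      by (simp add: w vector_scalar_commute cinner_scalar_left cinner_scalar_right)
  qed
  then have "?X $ (x, y) $ (x', y') = ?P $ x $ x' * Q $ y $ y'" for x y x' y'
    by (simp add: vec_eq_iff)
  then show ?thesis by (simp add: vec_eq_iff tensor_def)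
qed

lemma weighted_entropy_gram: "weighted_entropy (M ** adj M) = weighted_entropy (adj M ** M)"
proof -
  have tr: "trace (M ** adj M) = trace (adj M ** M)" by (rule trace_mul_sym)
  define p where "p = Re (trace (adj M ** M))"
  have p: "0 \<le> p" unfolding p_def by (intro psd_trace_nonneg psd_adj_mult)
  \<comment> \<open>For \<open>p = 0\<close> the default \<open>1 / 0 = 0\<close> makes
    \<open>N\<close> zero, and the two equations below still hold.\<close>
  define N where "N = sqrt (1 / p) *\<^sub>R M"
  have "N ** adj N = (1 / p) *\<^sub>R (M ** adj M)" "adj N ** N = (1 / p) *\<^sub>R (adj M ** M)"
    using p by (simp_all add: N_def adj_scaleR matrix_scaleR_left matrix_scaleR_right)
  then show ?thesis
    unfolding weighted_entropy_def tr p_def[symmetric] by (metis vn_entropy_gram)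
qed

text \<open>Additivity makes the two column factors a product, so each conditional operator on the
  last factor is a multiple of its marginal. The conditional operator on the row factor has the same
  weighted entropy, both being Gram matrices of one slice.\<close>

lemma entropy_additive_slices:
  fixes T :: "complex ^ ('x::finite \<times> 'y::finite) ^ 'a"
  assumes T: "trace (adj T ** T) = 1"
    and add: "vn_entropy (T ** adj T) = vn_entropy (ptrace_B (adj T ** T)) + vn_entropy (ptrace_A (adj T ** T))"
  shows "weighted_entropy (slice T w ** adj (slice T w)) =
    Re (trace (slice T w ** adj (slice T w))) * vn_entropy (ptrace_A (adj T ** T))"
proof -
  have "adj T ** T = tensor (ptrace_B (adj T ** T)) (ptrace_A (adj T ** T))"
    using entropy_additive_iff_product[of "adj T ** T"] add T
    by (simp add: density_op_def psd_adj_mult vn_entropy_gram)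
  from slice_product[OF this, of w] T
  have "weighted_entropy (adj (slice T w) ** slice T w) =
    Re (trace (adj (slice T w) ** slice T w)) * weighted_entropy (ptrace_A (adj T ** T))"
    by (metis trace_ptrace_A weighted_entropy_scaleR)
  then show ?thesis
    by (simp add: weighted_entropy_gram weighted_entropy_trace_1 trace_ptrace_A T trace_mul_sym[of "slice T w"])
qed

text \<open>The assumption is the reverse of the concavity bound, so equality holds there for every
  basis. All conditional operators are then multiples of the marginal, which yields a
  product.\<close>

lemma entropy_additive_if_slices:
  fixes T :: "complex ^ ('x::finite \<times> 'y::finite) ^ 'a"
  assumes T: "trace (adj T ** T) = 1"
    and le: "\<And>U. unitary U \<Longrightarrow> vn_entropy (ptrace_A (adj T ** T)) \<le>
      (\<Sum>k\<in>UNIV. weighted_entropy (slice T (column k U) ** adj (slice T (column k U))))"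
  shows "vn_entropy (T ** adj T) = vn_entropy (ptrace_B (adj T ** T)) + vn_entropy (ptrace_A (adj T ** T))"
proof -
  have "adj (slice T (column k U)) ** slice T (column k U) =
    Re (trace (adj (slice T (column k U)) ** slice T (column k U))) *\<^sub>R ptrace_A (adj T ** T)"
    if U: "unitary U" for U k
  proof -
    have tr: "trace (ptrace_A (adj T ** T)) = 1" by (simp add: trace_ptrace_A T)
    note c = entropy_concave[OF finite psd_adj_mult sum_slice_gram[OF U, symmetric] tr]
    show ?thesis
      using c(1) le[OF U] by (intro c(2)) (auto simp: weighted_entropy_gram)
  qed
  from product_if_slices[OF this] show ?thesis
    using entropy_additive_iff_product[of "adj T ** T"] T
    by (simp add: density_op_def psd_adj_mult vn_entropy_gram)
qed

subsection \<open>Purification\<close>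

lemma trace_normalised:
  assumes "psd M" "Re (trace M) \<noteq> 0"
  shows "trace ((1 / Re (trace M)) *\<^sub>R M) = 1"
proof -
  define p where "p = Re (trace M)"
  have "trace M = of_real p" using psd_trace_real[OF assms(1)] by (simp add: p_def)
  then show ?thesis
    using assms(2) by (simp add: trace_scaleR scaleR_conv_of_real[where 'a=complex] flip: p_def)
qed

text \<open>Concavity rescaled to arbitrary trace. It says that merging measurement outcomes cannot
  lower the average entropy.\<close>

lemma weighted_entropy_superadditive:
  fixes \<tau> :: "'k \<Rightarrow> complex ^ 'n ^ 'n"
  assumes K: "finite K" and \<tau>: "\<And>k. k \<in> K \<Longrightarrow> psd (\<tau> k)"
  shows "(\<Sum>k\<in>K. weighted_entropy (\<tau> k)) \<le> weighted_entropy (\<Sum>k\<in>K. \<tau> k)"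
proof -
  define p where "p = Re (trace (\<Sum>k\<in>K. \<tau> k))"
  have psd: "psd (\<Sum>k\<in>K. \<tau> k)" by (intro psd_sum \<tau>)
  have p0: "0 \<le> p" unfolding p_def by (intro psd_trace_nonneg psd)
  show ?thesis
  proof (cases "p = 0")
    case True
    then have "(\<Sum>k\<in>K. Re (trace (\<tau> k))) = 0" by (simp add: p_def trace_sum)
    then have "Re (trace (\<tau> k)) = 0" if "k \<in> K" for k
      using that K psd_trace_nonneg[OF \<tau>] by (simp add: sum_nonneg_eq_0_iff)
    then show ?thesis using True by (simp add: weighted_entropy_def flip: p_def)
  next
    case False
    define \<sigma> where "\<sigma> = (1 / p) *\<^sub>R (\<Sum>k\<in>K. \<tau> k)"
    have \<sigma>: "\<sigma> = (\<Sum>k\<in>K. (1 / p) *\<^sub>R \<tau> k)" by (simp add: \<sigma>_def scaleR_sum_right)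
    have tr: "trace \<sigma> = 1"
      using trace_normalised[OF psd] False by (simp add: \<sigma>_def p_def)
    have "psd ((1 / p) *\<^sub>R \<tau> k)" if "k \<in> K" for k using \<tau>[OF that] p0 by (intro psd_scaleR) auto
    from entropy_concave(1)[OF K this \<sigma> tr]
    have "(\<Sum>k\<in>K. weighted_entropy ((1 / p) *\<^sub>R \<tau> k)) \<le> weighted_entropy \<sigma>"
      by (simp add: weighted_entropy_trace_1 tr)
    then have "(\<Sum>k\<in>K. weighted_entropy (\<tau> k)) / p \<le> weighted_entropy (\<Sum>k\<in>K. \<tau> k) / p"
      by (simp add: \<sigma>_def weighted_entropy_scaleR flip: sum_divide_distrib)
    then show ?thesis using False p0 by (simp add: divide_le_cancel)
  qed
qed

lemma weighted_entropy_nonneg: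
  assumes "psd M"
  shows "0 \<le> weighted_entropy M"
proof (cases "Re (trace M) = 0")
  case False
  then have "density_op ((1 / Re (trace M)) *\<^sub>R M)"
    using assms psd_trace_nonneg[OF assms] trace_normalised[OF assms]
    by (simp add: density_op_def psd_scaleR)
  then show ?thesis
    using psd_trace_nonneg[OF assms] by (simp add: weighted_entropy_def vn_entropy_nonneg)
qed (simp add: weighted_entropy_def)

section \<open>Rank-one operators and the purifying factor\<close>

lemma psd_ketbra: "psd (ketbra v)"
proof -
  have "ketbra v = (\<chi> i (j::unit). v $ i) ** adj (\<chi> i j. v $ i)"
    by (simp add: ketbra_def adj_def matrix_matrix_mult_def vec_eq_iff UNIV_unit)
  then show ?thesis by (simp only: psd_mult_adj)
qed

lemma trace_ketbra: "trace (ketbra v) = of_real ((norm v)\<^sup>2)"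
proof -
  have "trace (ketbra v) = cinner v v"
    by (simp add: trace_def ketbra_def cinner_def mult.commute)
  then show ?thesis by (simp add: cinner_self)
qed

lemma ketbra_scaleR: "ketbra (c *\<^sub>R v) = c\<^sup>2 *\<^sub>R ketbra v"
  by (simp add: ketbra_def vec_eq_iff power2_eq_square)

lemma ketbra_matrix_vector: "ketbra (M *v v) = M ** ketbra v ** adj M"
  by (simp add: ketbra_def vec_eq_iff matrix_matrix_mult_def matrix_vector_mult_def adj_def
      sum_product sum_distrib_left sum_distrib_right mult_ac)

lemma sum_ketbra_columns: "(\<Sum>k\<in>UNIV. ketbra (column k M)) = M ** adj M"
  by (simp add: ketbra_def vec_eq_iff matrix_matrix_mult_def adj_def column_def)

text \<open>In the eigenbasis of \<open>\<rho>\<close> the diagonal of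
  \<open>\<rho> - ketbra v\<close> bounds the squared coordinates of \<open>v\<close> by the
  eigenvalues, so \<open>v\<close> lies in the range of the factor. Hence every vector of a pure
  ensemble can be reached from the environment.\<close>

lemma psd_factor_range:
  fixes \<rho> :: "complex ^ 'n ^ 'n"
  assumes "psd \<rho>"
  obtains \<Psi> :: "complex ^ 'n ^ 'n" where "\<rho> = \<Psi> ** adj \<Psi>"
    and "\<And>v. psd (\<rho> - ketbra v) \<Longrightarrow> \<exists>w. v = \<Psi> *v w"
proof -
  obtain U d where U: "unitary U" and \<rho>: "\<rho> = U ** real_diag d ** adj U" and d: "\<And>i. 0 \<le> d i"
    using psd_diagonalisation assms by blast
  define \<Psi> where "\<Psi> = U ** real_diag (\<lambda>i. sqrt (d i))"
  have "real_diag d = real_diag (\<lambda>i. sqrt (d i)) ** real_diag (\<lambda>i. sqrt (d i))"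
    using d by (simp add: real_diag_mult_real_diag)
  then have "\<rho> = \<Psi> ** adj \<Psi>"
    by (simp add: \<rho> \<Psi>_def adj_mult matrix_mul_assoc)
  moreover have "\<exists>w. v = \<Psi> *v w" if v: "psd (\<rho> - ketbra v)" for v
  proof -
    define u where "u = adj U *v v"
    have "adj U ** (\<rho> - ketbra v) ** U = real_diag d - ketbra u"
    proof -
      have "ketbra u = adj U ** ketbra v ** U"
        using ketbra_matrix_vector[of "adj U" v] by (simp add: u_def)
      moreover have "adj U ** \<rho> ** U = real_diag d"
        by (simp add: \<rho> matrix_mul_assoc unitary_cancel[OF U])
      moreover have "A ** (B - C) ** D = A ** B ** D - A ** C ** D" for A B C D :: "complex ^ 'n ^ 'n"
        by (simp add: vec_eq_iff matrix_matrix_mult_def algebra_simps sum_subtractf)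
      ultimately show ?thesis by simp
    qed
    then have "0 \<le> Re ((real_diag d - ketbra u) $ k $ k)" for k
      using psd_conj_diag[OF v, of U k] by simp
    then have "(cmod (u $ k))\<^sup>2 \<le> d k" for k
      by (simp add: real_diag_def ketbra_def flip: complex_norm_square)
    then have u0: "u $ k = 0" if "d k = 0" for k
      using that by (metis norm_eq_zero power2_less_eq_zero_iff)
    \<comment> \<open>Division by zero is harmless: where \<open>d k = 0\<close> the coordinate of
      \<open>u\<close> vanishes as well.\<close>
    define w where "w = (\<chi> k. u $ k / of_real (sqrt (d k)))"
    have "real_diag (\<lambda>i. sqrt (d i)) *v w = u"
    proof -
      have "(real_diag (\<lambda>i. sqrt (d i)) *v w) $ k = of_real (sqrt (d k)) * w $ k" for k
        by (simp add: matrix_vector_mult_def real_diag_def if_distrib if_distribR cong: if_cong)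
      then show ?thesis using u0 by (auto simp: vec_eq_iff w_def)
    qed
    then have "\<Psi> *v w = U *v u"
      by (simp add: \<Psi>_def flip: matrix_vector_mul_assoc)
    also have "\<dots> = v"
      using U by (simp add: u_def matrix_vector_mul_assoc unitary_def)
    finally show ?thesis by metis
  qed
  ultimately show ?thesis by (rule that)
qed

text \<open>The purification \<open>\<Psi>\<close> of a bipartite operator, as a tripartite vector with the environment
  placed last, respectively in the middle.\<close>

definition env_last :: "complex ^ 'c ^ ('a::finite \<times> 'b::finite) \<Rightarrow> complex ^ ('b \<times> 'c) ^ 'a" where
  "env_last \<Psi> = (\<chi> a p. \<Psi> $ (a, fst p) $ snd p)"

definition env_mid :: "complex ^ 'c ^ ('a::finite \<times> 'b::finite) \<Rightarrow> complex ^ ('c \<times> 'b) ^ 'a" where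
  "env_mid \<Psi> = (\<chi> a p. \<Psi> $ (a, snd p) $ fst p)"

text \<open>The three one-party marginals of the purification. That of the environment,
  \<open>adj \<Psi> ** \<Psi>\<close>, has the entropy of the purified operator by
  \<open>vn_entropy_gram\<close>.\<close>

lemma env_last_reduced:
  fixes \<Psi> :: "complex ^ 'c::finite ^ ('a::finite \<times> 'b::finite)"
  shows "env_last \<Psi> ** adj (env_last \<Psi>) = ptrace_B (\<Psi> ** adj \<Psi>)"
    and "ptrace_B (adj (env_last \<Psi>) ** env_last \<Psi>) = transpose (ptrace_A (\<Psi> ** adj \<Psi>))"
    and "ptrace_A (adj (env_last \<Psi>) ** env_last \<Psi>) = adj \<Psi> ** \<Psi>"
    apply (simp_all add: env_last_def ptrace_A_def ptrace_B_def transpose_def matrix_matrix_mult_def adj_def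
      vec_eq_iff sum_UNIV_prod mult.commute)
   apply (intro allI sum.swap)+
  done

lemma env_mid_reduced:
  fixes \<Psi> :: "complex ^ 'c::finite ^ ('a::finite \<times> 'b::finite)"
  shows "env_mid \<Psi> ** adj (env_mid \<Psi>) = ptrace_B (\<Psi> ** adj \<Psi>)"
    and "ptrace_A (adj (env_mid \<Psi>) ** env_mid \<Psi>) = transpose (ptrace_A (\<Psi> ** adj \<Psi>))"
    and "ptrace_B (adj (env_mid \<Psi>) ** env_mid \<Psi>) = adj \<Psi> ** \<Psi>"
    apply (simp_all add: env_mid_def ptrace_A_def ptrace_B_def transpose_def matrix_matrix_mult_def adj_def
      vec_eq_iff sum_UNIV_prod mult.commute)
   apply (intro allI sum.swap)+
  done

text \<open>A rank-one outcome on the environment leaves \<open>AB\<close> in a pure, unnormalised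
  state; this links measurements on the environment with ensembles.\<close>

lemma slice_env_mid:
  "slice (env_mid \<Psi>) w ** adj (slice (env_mid \<Psi>) w) = ptrace_B (ketbra (\<Psi> *v w))"
  by (simp add: slice_def env_mid_def ptrace_B_def ketbra_def matrix_matrix_mult_def
      matrix_vector_mult_def adj_def vec_eq_iff)

text \<open>A rank-one outcome on \<open>B\<close>. The conjugate appears because
  \<open>slice\<close> contracts bilinearly.\<close>

lemma slice_env_last:
  fixes \<Psi> :: "complex ^ 'c::finite ^ ('a::finite \<times> 'b::finite)"
  shows "slice (env_last \<Psi>) w ** adj (slice (env_last \<Psi>) w) =
    ptrace_B (tensor (mat 1) (ketbra (\<chi> i. cnj (w $ i))) ** (\<Psi> ** adj \<Psi>))"
proof -
  have "(slice (env_last \<Psi>) w ** adj (slice (env_last \<Psi>) w)) $ a $ a' =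
      (\<Sum>c\<in>UNIV. \<Sum>b\<in>UNIV. \<Sum>b'\<in>UNIV. \<Psi> $ (a, b) $ c * w $ b * (cnj (\<Psi> $ (a', b') $ c) * cnj (w $ b')))" for a a'
    by (simp add: slice_def env_last_def matrix_matrix_mult_def adj_def sum_product)
  also have "\<dots> a a' = (\<Sum>b'\<in>UNIV. \<Sum>b\<in>UNIV. \<Sum>c\<in>UNIV. \<Psi> $ (a, b) $ c * w $ b * (cnj (\<Psi> $ (a', b') $ c) * cnj (w $ b')))" for a a'
    by (subst sum.swap, subst (2) sum.swap, subst sum.swap, rule refl)
  also have "\<dots> a a' = ptrace_B (tensor (mat 1) (ketbra (\<chi> i. cnj (w $ i))) ** (\<Psi> ** adj \<Psi>)) $ a $ a'" for a a'
    by (simp add: ptrace_B_def tensor_1_entries)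
       (simp add: ketbra_def matrix_matrix_mult_def adj_def sum_distrib_left mult_ac)
  finally show ?thesis by (simp add: vec_eq_iff)
qed

subsection \<open>Discord and entanglement of formation\<close>

text \<open>Leaving the conditional state unnormalised makes it additive in the effect and avoids
  division by its probability.\<close>

definition measured :: "complex ^ ('a::finite \<times> 'b::finite) ^ ('a \<times> 'b) \<Rightarrow> complex ^ 'b ^ 'b \<Rightarrow> complex ^ 'a ^ 'a" where
  "measured \<rho> F = ptrace_B (tensor (mat 1) F ** \<rho>)"

lemma measured_mat_1: "measured \<rho> (mat 1) = ptrace_B \<rho>"
  by (simp add: measured_def tensor_mat_1)

lemma measured_sum: "measured \<rho> (\<Sum>k\<in>K. F k) = (\<Sum>k\<in>K. measured \<rho> (F k))"
proof -
  have "measured \<rho> (F + G) = measured \<rho> F + measured \<rho> G" for F G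
    by (simp add: measured_def ptrace_B_def vec_eq_iff tensor_1_entries algebra_simps sum.distrib)
  moreover have "measured \<rho> 0 = 0"
    by (simp add: measured_def ptrace_B_def vec_eq_iff tensor_1_entries)
  ultimately show ?thesis
    by (induction K rule: infinite_finite_induct) simp_all
qed

lemma measured_gain_eq:
  "measured_gain \<rho> n E = vn_entropy (ptrace_B \<rho>) - (\<Sum>i<n. weighted_entropy (measured \<rho> (E i)))"
proof -
  have "outcome_prob \<rho> F = Re (trace (measured \<rho> F))" for F
    by (simp add: outcome_prob_def measured_def trace_ptrace_B)
  then have w: "weighted_entropy (measured \<rho> F) = outcome_prob \<rho> F * vn_entropy (post_state \<rho> F)" for F
    by (simp add: weighted_entropy_def post_state_def measured_def)
  have "(\<Sum>i | i < n \<and> outcome_prob \<rho> (E i) \<noteq> 0. outcome_prob \<rho> (E i) * vn_entropy (post_state \<rho> (E i))) =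
      (\<Sum>i<n. outcome_prob \<rho> (E i) * vn_entropy (post_state \<rho> (E i)))"
    by (rule sum.mono_neutral_left) auto
  then show ?thesis by (simp add: measured_gain_def w)
qed

lemma psd_sum_ketbra:
  fixes F :: "complex ^ 'n ^ 'n"
  assumes "psd F"
  obtains v :: "'n \<Rightarrow> complex ^ 'n" where "F = (\<Sum>k\<in>UNIV. ketbra (\<chi> i. cnj (v k $ i)))"
proof -
  obtain N :: "complex ^ 'n ^ 'n" where "F = adj N ** N" using psd_gram assms by blast
  then have "F = (\<Sum>k\<in>UNIV. ketbra (\<chi> i. cnj (N $ k $ i)))"
    by (simp add: vec_eq_iff matrix_matrix_mult_def adj_def ketbra_def)
  then show ?thesis by (rule that)
qed

text \<open>POVMs and ensembles are indexed by initial segments of the naturals, columns of a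
  unitary by a finite type; this translates between the two.\<close>

lemma obtain_enumeration:
  obtains h :: "nat \<Rightarrow> 'k::finite" where "bij_betw h {..<CARD('k)} UNIV"
  using ex_bij_betw_nat_finite[of "UNIV :: 'k set"] by (auto simp: atLeast0LessThan)

lemma vn_entropy_transpose_ptrace_A:
  assumes "psd \<rho>"
  shows "vn_entropy (transpose (ptrace_A \<rho>)) = vn_entropy (ptrace_A \<rho>)"
  using psd_ptrace_A[OF assms] by (intro vn_entropy_transpose) (simp add: psd_def)

lemma column_povm:
  fixes U :: "complex ^ 'b ^ 'b"
  assumes U: "unitary U" and h: "bij_betw h {..<CARD('b)} UNIV"
  shows "povm CARD('b) (\<lambda>i. ketbra (\<chi> j. cnj (column (h i) U $ j)))"
proof -
  have "(\<Sum>i<CARD('b). ketbra (\<chi> j. cnj (column (h i) U $ j))) = (\<Sum>k\<in>UNIV. ketbra (\<chi> j. cnj (column k U $ j)))"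
    by (rule sum.reindex_bij_betw[OF h])
  also have "\<dots> = transpose (U ** adj U)"
    by (simp add: vec_eq_iff ketbra_def column_def transpose_def matrix_matrix_mult_def adj_def mult.commute)
  also have "\<dots> = mat 1" using U by (simp add: unitary_def transpose_mat)
  finally show ?thesis by (simp add: povm_def psd_ketbra)
qed

text \<open>Cancelling \<open>S(B)\<close> leaves the claim that the supremum is
  \<open>S(A) - S(AB)\<close>. One direction uses it only as an upper bound on basis measurements;
  the other shows that this value is a maximum.\<close>

lemma discord_eq_iff:
  fixes \<rho> :: "complex ^ ('a::finite \<times> 'b::finite) ^ ('a \<times> 'b)"
  assumes "density_op \<rho>"
  shows "discord \<rho> = vn_entropy (ptrace_A \<rho>) \<longleftrightarrow>
         vn_entropy (ptrace_B \<rho>) - vn_entropy (ptrace_A \<rho>) = vn_entropy \<rho>"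
proof -
  have \<rho>: "psd \<rho>" "trace \<rho> = 1" using assms by (auto simp: density_op_def)
  obtain \<Psi> :: "complex ^ ('a \<times> 'b) ^ ('a \<times> 'b)" where \<Psi>: "\<rho> = \<Psi> ** adj \<Psi>"
    using psd_factor_range[OF \<rho>(1)] by blast
  define T where "T = env_last \<Psi>"
  have T: "trace (adj T ** T) = 1" "vn_entropy (T ** adj T) = vn_entropy (ptrace_B \<rho>)"
    "vn_entropy (ptrace_B (adj T ** T)) = vn_entropy (ptrace_A \<rho>)"
    "vn_entropy (ptrace_A (adj T ** T)) = vn_entropy \<rho>"
  proof -
    show "trace (adj T ** T) = 1"
      using \<rho>(2) by (simp add: T_def trace_mul_sym[of "adj _"] env_last_reduced trace_ptrace_B flip: \<Psi>)
  qed (simp_all add: T_def env_last_reduced vn_entropy_transpose_ptrace_A \<rho> vn_entropy_gram[of \<Psi>, symmetric] flip: \<Psi>)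
  have slice: "slice T w ** adj (slice T w) = measured \<rho> (ketbra (\<chi> i. cnj (w $ i)))" for w
    by (simp add: T_def slice_env_last measured_def \<Psi>)
  have psd_measured: "psd (measured \<rho> F)" if F: "psd F" for F
  proof -
    obtain v :: "'b \<Rightarrow> complex ^ 'b" where "F = (\<Sum>k\<in>UNIV. ketbra (\<chi> i. cnj (v k $ i)))"
      using psd_sum_ketbra[OF F] by blast
    then have "measured \<rho> F = (\<Sum>k\<in>UNIV. slice T (v k) ** adj (slice T (v k)))"
      by (simp add: measured_sum slice)
    then show ?thesis by (simp add: psd_sum psd_mult_adj)
  qed
  define G where "G = {measured_gain \<rho> n E | n E. povm n E}"
  \<comment> \<open>A crude bound from nonnegativity of the entropy, which makes
    \<open>cSup_upper\<close> applicable.\<close>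
  have le_SA: "g \<le> vn_entropy (ptrace_B \<rho>)" if "g \<in> G" for g
    using that by (auto simp: G_def measured_gain_eq povm_def intro!: sum_nonneg weighted_entropy_nonneg psd_measured)
  then have bdd: "bdd_above G" by (auto simp: bdd_above_def)
  have U_gain: "vn_entropy (ptrace_B \<rho>) -
      (\<Sum>k\<in>UNIV. weighted_entropy (slice T (column k U) ** adj (slice T (column k U)))) \<in> G"
    if U: "unitary U" for U
  proof -
    obtain h :: "nat \<Rightarrow> 'b" where h: "bij_betw h {..<CARD('b)} UNIV"
      by (rule obtain_enumeration)
    let ?E = "\<lambda>i. ketbra (\<chi> j. cnj (column (h i) U $ j))"
    have "measured_gain \<rho> CARD('b) ?E = vn_entropy (ptrace_B \<rho>) -
        (\<Sum>i<CARD('b). weighted_entropy (slice T (column (h i) U) ** adj (slice T (column (h i) U))))"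
      by (simp add: measured_gain_eq slice)
    also have "(\<Sum>i<CARD('b). weighted_entropy (slice T (column (h i) U) ** adj (slice T (column (h i) U)))) =
        (\<Sum>k\<in>UNIV. weighted_entropy (slice T (column k U) ** adj (slice T (column k U))))"
      by (rule sum.reindex_bij_betw[OF h])
    finally have eq: "measured_gain \<rho> CARD('b) ?E = vn_entropy (ptrace_B \<rho>) -
        (\<Sum>k\<in>UNIV. weighted_entropy (slice T (column k U) ** adj (slice T (column k U))))" .
    show ?thesis
      unfolding G_def by (intro CollectI exI conjI, rule eq[symmetric], rule column_povm[OF U h])
  qed
  have "discord \<rho> = vn_entropy (ptrace_A \<rho>) \<longleftrightarrow> Sup G = vn_entropy (ptrace_B \<rho>) - vn_entropy \<rho>"
    by (auto simp: discord_def mutual_information_def classical_correlation_def G_def)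
  also have "\<dots> \<longleftrightarrow> vn_entropy (ptrace_B \<rho>) = vn_entropy (ptrace_A \<rho>) + vn_entropy \<rho>"
  proof
    assume Sup: "Sup G = vn_entropy (ptrace_B \<rho>) - vn_entropy \<rho>"
    show "vn_entropy (ptrace_B \<rho>) = vn_entropy (ptrace_A \<rho>) + vn_entropy \<rho>"
      unfolding T(2-4)[symmetric]
    proof (rule entropy_additive_if_slices[OF T(1)])
      fix U :: "complex ^ 'b ^ 'b"
      assume "unitary U"
      from cSup_upper[OF U_gain[OF this] bdd]
      show "vn_entropy (ptrace_A (adj T ** T)) \<le>
          (\<Sum>k\<in>UNIV. weighted_entropy (slice T (column k U) ** adj (slice T (column k U))))"
        by (simp add: Sup T)
    qed
  next
    assume "vn_entropy (ptrace_B \<rho>) = vn_entropy (ptrace_A \<rho>) + vn_entropy \<rho>"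
    then have "weighted_entropy (slice T w ** adj (slice T w)) =
        Re (trace (slice T w ** adj (slice T w))) * vn_entropy \<rho>" for w
      using entropy_additive_slices[OF T(1)] by (simp add: T)
    note slices = this[unfolded slice]
    \<comment> \<open>Refine \<open>F\<close> into rank-one effects. For these the weighted entropy
      is exactly the probability times \<open>S(AB)\<close>, and merging them back cannot lower
      it.\<close>
    have lower: "Re (trace (measured \<rho> F)) * vn_entropy \<rho> \<le> weighted_entropy (measured \<rho> F)" if F: "psd F" for F
    proof -
      obtain v :: "'b \<Rightarrow> complex ^ 'b" where v: "F = (\<Sum>k\<in>UNIV. ketbra (\<chi> i. cnj (v k $ i)))"
        using psd_sum_ketbra[OF F] by blast
      have "Re (trace (measured \<rho> F)) * vn_entropy \<rho> =
          (\<Sum>k\<in>UNIV. weighted_entropy (measured \<rho> (ketbra (\<chi> i. cnj (v k $ i)))))"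
        by (simp add: v measured_sum trace_sum slices sum_distrib_right)
      also have "\<dots> \<le> weighted_entropy (measured \<rho> F)"
        unfolding v measured_sum
        by (intro weighted_entropy_superadditive finite psd_measured psd_ketbra)
      finally show ?thesis .
    qed
    have prob: "(\<Sum>i<n. Re (trace (measured \<rho> (E i)))) = 1" if "povm n E" for n E
    proof -
      have "(\<Sum>i<n. trace (measured \<rho> (E i))) = 1"
        using that \<rho> by (simp add: povm_def measured_mat_1 trace_ptrace_B flip: trace_sum measured_sum)
      then show ?thesis by (metis Re_sum one_complex.sel(1))
    qed
    show "Sup G = vn_entropy (ptrace_B \<rho>) - vn_entropy \<rho>"
    proof (rule cSup_eq_maximum)
      fix g assume "g \<in> G"
      then obtain n E where g: "g = measured_gain \<rho> n E" and E: "povm n E" by (auto simp: G_def)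
      have "vn_entropy \<rho> = (\<Sum>i<n. Re (trace (measured \<rho> (E i))) * vn_entropy \<rho>)"
        by (simp add: prob[OF E] flip: sum_distrib_right)
      also have "\<dots> \<le> (\<Sum>i<n. weighted_entropy (measured \<rho> (E i)))"
        using E by (intro sum_mono lower) (simp add: povm_def)
      finally show "g \<le> vn_entropy (ptrace_B \<rho>) - vn_entropy \<rho>"
        by (simp add: g measured_gain_eq)
    next
      obtain h :: "nat \<Rightarrow> 'b" where h: "bij_betw h {..<CARD('b)} UNIV"
        by (rule obtain_enumeration)
      \<comment> \<open>Any orthonormal basis attains the bound; the standard one is taken.\<close>
      have U: "unitary (mat 1 :: complex ^ 'b ^ 'b)"
        by (rule unitary_mat_1)
      note E = column_povm[OF U h]
      have eq: "measured_gain \<rho> CARD('b) (\<lambda>i. ketbra (\<chi> j. cnj (column (h i) (mat 1) $ j))) =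
          vn_entropy (ptrace_B \<rho>) - vn_entropy \<rho>"
        by (simp add: measured_gain_eq slices prob[OF E] flip: sum_distrib_right)
      show "vn_entropy (ptrace_B \<rho>) - vn_entropy \<rho> \<in> G"
        unfolding G_def by (intro CollectI exI conjI, rule eq[symmetric], rule E)
    qed
  qed
  finally show ?thesis by auto
qed

text \<open>One direction uses the infimum only as a lower bound on ensembles coming from bases of
  the environment; the other shows that all ensembles have the same average.\<close>

lemma ent_formation_eq_iff:
  fixes \<rho> :: "complex ^ ('a::finite \<times> 'b::finite) ^ ('a \<times> 'b)"
  assumes "density_op \<rho>"
  shows "ent_formation \<rho> = vn_entropy (ptrace_A \<rho>) \<longleftrightarrow>
         vn_entropy (ptrace_B \<rho>) - vn_entropy (ptrace_A \<rho>) = vn_entropy \<rho>"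
proof -
  have \<rho>: "psd \<rho>" "trace \<rho> = 1" using assms by (auto simp: density_op_def)
  obtain \<Psi> :: "complex ^ ('a \<times> 'b) ^ ('a \<times> 'b)" where \<Psi>: "\<rho> = \<Psi> ** adj \<Psi>"
    and range: "\<And>v. psd (\<rho> - ketbra v) \<Longrightarrow> \<exists>w. v = \<Psi> *v w"
    using psd_factor_range[OF \<rho>(1)] by blast
  define T where "T = env_mid \<Psi>"
  have T: "trace (adj T ** T) = 1" "vn_entropy (T ** adj T) = vn_entropy (ptrace_B \<rho>)"
    "vn_entropy (ptrace_A (adj T ** T)) = vn_entropy (ptrace_A \<rho>)"
    "vn_entropy (ptrace_B (adj T ** T)) = vn_entropy \<rho>"
  proof -
    show "trace (adj T ** T) = 1"
      using \<rho>(2) by (simp add: T_def trace_mul_sym[of "adj _"] env_mid_reduced trace_ptrace_B flip: \<Psi>)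
  qed (simp_all add: T_def env_mid_reduced vn_entropy_transpose_ptrace_A \<rho> vn_entropy_gram[of \<Psi>, symmetric] flip: \<Psi>)
  have slice: "slice T w ** adj (slice T w) = ptrace_B (ketbra (\<Psi> *v w))" for w
    by (simp add: T_def slice_env_mid)
  have unit_state: "trace (ptrace_B (ketbra v)) = 1" if "norm v = 1" for v :: "complex ^ ('a \<times> 'b)"
    using that by (simp add: trace_ptrace_B trace_ketbra)
  have ptrace_ketbra_scaleR: "ptrace_B (ketbra (c *\<^sub>R v)) = c\<^sup>2 *\<^sub>R ptrace_B (ketbra v)" for c and v :: "complex ^ ('a \<times> 'b)"
    by (simp add: ketbra_scaleR) (simp add: ptrace_B_def vec_eq_iff scaleR_sum_right)
  define G where "G = {(\<Sum>i<n. p i * vn_entropy (ptrace_B (ketbra (\<psi> i)))) | n p \<psi>. pure_ensemble \<rho> n p \<psi>}"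
  have "0 \<le> g" if "g \<in> G" for g
  proof -
    have "0 \<le> vn_entropy (ptrace_B (ketbra v))" if "norm v = 1" for v :: "complex ^ ('a \<times> 'b)"
      by (intro vn_entropy_nonneg) (simp add: density_op_def psd_ptrace_B psd_ketbra unit_state[OF that])
    then show ?thesis using that by (auto simp: G_def pure_ensemble_def intro!: sum_nonneg mult_nonneg_nonneg)
  qed
  then have bdd: "bdd_below G" by (auto simp: bdd_below_def)
  have U_value: "(\<Sum>k\<in>UNIV. weighted_entropy (slice T (column k U) ** adj (slice T (column k U)))) \<in> G"
    if U: "unitary U" for U
  proof -
    obtain h :: "nat \<Rightarrow> 'a \<times> 'b" where h: "bij_betw h {..<CARD('a \<times> 'b)} UNIV"
      by (rule obtain_enumeration)
    define v where "v k = \<Psi> *v column k U" for k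
    define p where "p k = (norm (v k))\<^sup>2" for k
    \<comment> \<open>A zero vector has weight \<open>p k = 0\<close>; an arbitrary unit vector
      replaces it because an ensemble requires norm one at every index.\<close>
    define \<psi> where "\<psi> k = (if v k = 0 then axis undefined 1 else (1 / norm (v k)) *\<^sub>R v k)" for k
    have norm: "norm (\<psi> k) = 1" for k by (simp add: \<psi>_def)
    have v: "v k = norm (v k) *\<^sub>R \<psi> k" for k by (simp add: \<psi>_def)
    have kv: "ketbra (v k) = p k *\<^sub>R ketbra (\<psi> k)" for k
      by (metis ketbra_scaleR p_def v)
    have "(\<Sum>k\<in>UNIV. ketbra (v k)) = \<Psi> ** (\<Sum>k\<in>UNIV. ketbra (column k U)) ** adj \<Psi>"
      by (simp add: v_def ketbra_matrix_vector matrix_sum_left matrix_sum_right)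
    also have "\<dots> = \<rho>" using U by (simp add: sum_ketbra_columns unitary_def \<Psi>)
    finally have sum: "(\<Sum>k\<in>UNIV. ketbra (v k)) = \<rho>" .
    have "complex_of_real (\<Sum>k\<in>UNIV. p k) = of_real 1"
      using arg_cong[OF sum, of trace] \<rho>(2) by (simp add: trace_sum trace_ketbra p_def)
    then have sum_p: "(\<Sum>k\<in>UNIV. p k) = 1" by (simp only: of_real_eq_iff)
    have ens: "pure_ensemble \<rho> CARD('a \<times> 'b) (\<lambda>i. p (h i)) (\<lambda>i. \<psi> (h i))"
      unfolding pure_ensemble_def kv[symmetric] sum.reindex_bij_betw[OF h, of p]
        sum.reindex_bij_betw[OF h, of "\<lambda>k. ketbra (v k)"]
      using sum sum_p norm by (simp add: p_def)
    have w: "weighted_entropy (slice T (column k U) ** adj (slice T (column k U))) =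
        p k * vn_entropy (ptrace_B (ketbra (\<psi> k)))" for k
    proof -
      have "slice T (column k U) ** adj (slice T (column k U)) = ptrace_B (ketbra (norm (v k) *\<^sub>R \<psi> k))"
        by (simp add: slice flip: v v_def)
      then show ?thesis
        by (simp add: ptrace_ketbra_scaleR weighted_entropy_scaleR weighted_entropy_trace_1 unit_state[OF norm] p_def)
    qed
    have eq: "(\<Sum>i<CARD('a \<times> 'b). p (h i) * vn_entropy (ptrace_B (ketbra (\<psi> (h i))))) =
        (\<Sum>k\<in>UNIV. weighted_entropy (slice T (column k U) ** adj (slice T (column k U))))"
      unfolding w by (rule sum.reindex_bij_betw[OF h])
    show ?thesis
      unfolding G_def by (intro CollectI exI conjI, rule eq[symmetric], rule ens)
  qed
  have "ent_formation \<rho> = vn_entropy (ptrace_A \<rho>) \<longleftrightarrow> Inf G = vn_entropy (ptrace_A \<rho>)"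
    by (simp add: ent_formation_def G_def)
  also have "\<dots> \<longleftrightarrow> vn_entropy (ptrace_B \<rho>) = vn_entropy \<rho> + vn_entropy (ptrace_A \<rho>)"
  proof
    assume Inf: "Inf G = vn_entropy (ptrace_A \<rho>)"
    show "vn_entropy (ptrace_B \<rho>) = vn_entropy \<rho> + vn_entropy (ptrace_A \<rho>)"
      unfolding T(2-4)[symmetric]
    proof (rule entropy_additive_if_slices[OF T(1)])
      fix U :: "complex ^ ('a \<times> 'b) ^ ('a \<times> 'b)"
      assume "unitary U"
      from cInf_lower[OF U_value[OF this] bdd]
      show "vn_entropy (ptrace_A (adj T ** T)) \<le>
          (\<Sum>k\<in>UNIV. weighted_entropy (slice T (column k U) ** adj (slice T (column k U))))"
        by (simp add: Inf T)
    qed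
  next
    assume "vn_entropy (ptrace_B \<rho>) = vn_entropy \<rho> + vn_entropy (ptrace_A \<rho>)"
    then have slices: "weighted_entropy (ptrace_B (ketbra (\<Psi> *v w))) =
        Re (trace (ptrace_B (ketbra (\<Psi> *v w)))) * vn_entropy (ptrace_A \<rho>)" for w
      using entropy_additive_slices[OF T(1), of w] by (simp add: T slice)
    have const: "g = vn_entropy (ptrace_A \<rho>)" if gG: "g \<in> G" for g
    proof -
      obtain n p \<psi> where g: "g = (\<Sum>i<n. p i * vn_entropy (ptrace_B (ketbra (\<psi> i))))"
        and ens: "pure_ensemble \<rho> n p \<psi>" using gG by (auto simp: G_def)
      have p: "0 \<le> p i" and norm: "norm (\<psi> i) = 1" if "i < n" for i
        using ens that by (auto simp: pure_ensemble_def)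
      have "p i * vn_entropy (ptrace_B (ketbra (\<psi> i))) = p i * vn_entropy (ptrace_A \<rho>)" if i: "i < n" for i
      proof -
        \<comment> \<open>Subtracting this one term leaves the rest of the ensemble, which is
          positive, so the range property of \<open>\<Psi>\<close> provides an environment vector
          for it.\<close>
        let ?v = "sqrt (p i) *\<^sub>R \<psi> i"
        have "\<rho> - ketbra ?v = (\<Sum>j\<in>{..<n} - {i}. p j *\<^sub>R ketbra (\<psi> j))"
          using ens i p[OF i] by (simp add: pure_ensemble_def ketbra_scaleR sum.remove[of "{..<n}" i])
        also have "psd \<dots>" by (intro psd_sum psd_scaleR psd_ketbra) (auto intro: p)
        finally obtain w where "?v = \<Psi> *v w" using range by blast
        then have "weighted_entropy (ptrace_B (ketbra ?v)) = Re (trace (ptrace_B (ketbra ?v))) * vn_entropy (ptrace_A \<rho>)"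
          using slices[of w] by simp
        then show ?thesis
          using p[OF i] by (simp add: ptrace_ketbra_scaleR weighted_entropy_scaleR weighted_entropy_trace_1
              unit_state[OF norm[OF i]] trace_scaleR)
      qed
      then have "g = (\<Sum>i<n. p i * vn_entropy (ptrace_A \<rho>))"
        unfolding g by (intro sum.cong refl) simp
      also have "\<dots> = vn_entropy (ptrace_A \<rho>)"
        using ens by (simp add: pure_ensemble_def flip: sum_distrib_right)
      finally show ?thesis .
    qed
    have "G \<noteq> {}"
      using U_value[OF unitary_mat_1] by blast
    then have "G = {vn_entropy (ptrace_A \<rho>)}" using const by blast
    then show "Inf G = vn_entropy (ptrace_A \<rho>)" by simp
  qed
  finally show ?thesis by auto
qed

theorem lemma2:
  fixes \<rho> :: "complex ^ ('a::finite \<times> 'b::finite) ^ ('a \<times> 'b)"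
  assumes "density_op \<rho>"
  shows "(discord \<rho> = vn_entropy (ptrace_A \<rho>) \<longleftrightarrow>
            vn_entropy (ptrace_B \<rho>) - vn_entropy (ptrace_A \<rho>) = vn_entropy \<rho>) \<and>
         (vn_entropy (ptrace_B \<rho>) - vn_entropy (ptrace_A \<rho>) = vn_entropy \<rho> \<longleftrightarrow>
            ent_formation \<rho> = vn_entropy (ptrace_A \<rho>))"
  using discord_eq_iff[OF assms] ent_formation_eq_iff[OF assms] by blast

end
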